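(* Let $a,b\in\mathbb{R}$ with $a\neq 0$, $b\neq 0$, and let $(L,H,G)$ be the 4-dimensional almost hypercomplex manifold with Hermitian-Norden metrics constructed (as in the context) on a simply connected 4-dimensional real Lie group $L$ whose Lie algebra is $g_{4,5}$ with parameters $a,b$. Then $(L,H,G)$ belongs to the following classes with respect to $J_1$, $J_2$, $J_3$, depending on $a$ and $b$ (each row lists the condition on $(a,b)$; then the class w.r.t. $J_1$; w.r.t. $J_2$; w.r.t. $J_3$): \begin{itemize} \item $a=-1$, $b=1$: $\mathcal{W}_2$; $\mathcal{W}_2$; $\mathcal{W}_1\oplus\mathcal{W}_2\oplus\mathcal{W}_3$. \item $a=-1$, $b=-1$: $\mathcal{W}_2$; $\mathcal{W}_1\oplus\mathcal{W}_2\oplus\mathcal{W}_3$; $\mathcal{W}_2$. \item $a=-1$, $b\neq\pm1$: $\mathcal{W}_2$; $\mathcal{W}_1\oplus\mathcal{W}_2\oplus\mathcal{W}_3$; $\mathcal{W}_1\oplus\mathcal{W}_2\oplus\mathcal{W}_3$. \item $a=1$, $b=1$: $\mathcal{W}_4$; $\mathcal{W}_1$; $\mathcal{W}_1\oplus\mathcal{W}_2$. \item $a=1$, $b=-3$: $\mathcal{W}_4$; $\mathcal{W}_2\oplus\mathcal{W}_3$; $\mathcal{W}_2\oplus\mathcal{W}_3$. \item $a=1$, $b\neq1$ and $b\neq-3$: $\mathcal{W}_4$; $\mathcal{W}_1\oplus\mathcal{W}_2\oplus\mathcal{W}_3$; $\mathcal{W}_1\oplus\mathcal{W}_2\oplus\mathcal{W}_3$.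 \item $a\neq\pm1$, $b=1$: $\mathcal{W}_2\oplus\mathcal{W}_4$; $\mathcal{W}_1\oplus\mathcal{W}_2$; $\mathcal{W}_1\oplus\mathcal{W}_2\oplus\mathcal{W}_3$. \item $a=-\frac13$, $b=-\frac13$: $\mathcal{W}_2\oplus\mathcal{W}_4$; $\mathcal{W}_2\oplus\mathcal{W}_3$; $\mathcal{W}_1\oplus\mathcal{W}_2$. \item $a=-\frac12(b+1)$, $b\neq-3$ and $b\neq-\frac13$: $\mathcal{W}_2\oplus\mathcal{W}_4$; $\mathcal{W}_2\oplus\mathcal{W}_3$; $\mathcal{W}_1\oplus\mathcal{W}_2\oplus\mathcal{W}_3$. \item $a=b$, $b\neq\pm1$ and $b\neq-\frac13$: $\mathcal{W}_2\oplus\mathcal{W}_4$; $\mathcal{W}_1\oplus\mathcal{W}_2\oplus\mathcal{W}_3$; $\mathcal{W}_1\oplus\mathcal{W}_2$. \item $a=-b-2$, $b\neq-1$ and $b\neq-3$: $\mathcal{W}_2\oplus\mathcal{W}_4$; $\mathcal{W}_1\oplus\mathcal{W}_2\oplus\mathcal{W}_3$; $\mathcal{W}_2\oplus\mathcal{W}_3$. \item $a\neq0$, $b\neq0$: $\mathcal{W}_2\oplus\mathcal{W}_4$; $\mathcal{W}_1\oplus\mathcal{W}_2\oplus\mathcal{W}_3$; $\mathcal{W}_1\oplus\mathcal{W}_2\oplus\mathcal{W}_3$. \end{itemize}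
   Context: Lie algebra. $g_{4,5}$ is the real Lie algebra with basis $\{e_1,e_2,e_3,e_4\}$ whose only non-zero brackets (up to antisymmetry) are $[e_1,e_4]=e_1$, $[e_2,e_4]=a e_2$, $[e_3,e_4]=b e_3$, with $a\neq0$, $b\neq0$. The $e_i$ are regarded as left-invariant vector fields on $L$. Structure. Left-invariant almost complex structures $J_1,J_2,J_3$ are defined by $J_1e_1=e_2$, $J_1e_2=-e_1$, $J_1e_3=-e_4$, $J_1e_4=e_3$; $J_2e_1=e_3$, $J_2e_2=e_4$, $J_2e_3=-e_1$, $J_2e_4=-e_2$; $J_3e_1=-e_4$, $J_3e_2=e_3$, $J_3e_3=-e_2$, $J_3e_4=e_1$; and $H=(J_1,J_2,J_3)$. The left-invariant neutral metric $g$ is $g(x,y)=x^1y^1+x^2y^2-x^3y^3-x^4y^4$ for $x=\sum_i x^ie_i$, $y=\sum_i y^ie_i$. Put $\varepsilon_1=1$, $\varepsilon_2=\varepsilon_3=-1$; then $g(x,y)=\varepsilon_\alpha g(J_\alpha x,J_\alpha y)$ for $\alpha=1,2,3$. Set $g_\alpha(x,y)=g(J_\alpha x,y)$ and $G=(g,g_1,g_2,g_3)$. Fundamental tensors. Let $\nabla$ be the Levi-Civita connection of $g$, $F_\alpha(x,y,z)=g((\nabla_xJ_\alpha)y,z)$, and let $\theta_\alpha(z)=g^{kl}F_\alpha(e_k,e_l,z)$ be the corresponding Lee form. One has $F_\alpha(x,y,z)=-\varepsilon_\alpha F_\alpha(x,z,y)=-\varepsilon_\alpha F_\alpha(x,J_\alpha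 y,J_\alpha z)$. Below, $\mathfrak{S}_{x,y,z}$ denotes the cyclic sum over $x,y,z$. Classes in dimension 4. With respect to $J_1$: $\mathcal{W}_2$: $\mathfrak{S}_{x,y,z}F_1(x,y,z)=0$; $\mathcal{W}_4$: $F_1(x,y,z)=\frac12\{g(x,y)\theta_1(z)-g(x,J_1y)\theta_1(J_1z)-g(x,z)\theta_1(y)+g(x,J_1z)\theta_1(J_1y)\}$. With respect to $J_\alpha$, $\alpha=2,3$: $\mathcal{W}_1$: $F_\alpha(x,y,z)=\frac14\{g(x,y)\theta_\alpha(z)+g(x,J_\alpha y)\theta_\alpha(J_\alpha z)+g(x,z)\theta_\alpha(y)+g(x,J_\alpha z)\theta_\alpha(J_\alpha y)\}$; $\mathcal{W}_2$: $\mathfrak{S}_{x,y,z}F_\alpha(x,y,J_\alpha z)=0$ and $\theta_\alpha=0$; $\mathcal{W}_3$: $\mathfrak{S}_{x,y,z}F_\alpha(x,y,z)=0$. As is standard for the Gray–Hervella and Ganchev–Borisov classifications, each condition defines a linear subspace of the space of $(0,3)$-tensors $F$ satisfying $F(x,y,z)=-\varepsilon_\alpha F(x,z,y)=-\varepsilon_\alpha F(x,J_\alpha y,J_\alpha z)$ (with $\theta$ the trace of $F$ defined by $\theta(z)=g^{kl}F(e_k,e_l,z)$); a manifold belongs to a basic class w.r.t. $J_\alpha$ if $F_\alpha$ lies in this subspace at each point, and it belongs to a direct sum of basic classes if $F_\alpha$ lies in the sum of the corresponding subspaces at each point. *)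

theory Defs
  imports
    "HOL-Analysis.Analysis"
    "HOL-Library.Function_Algebras"
    "HOL-Library.Set_Algebras"
    "HOL-Algebra.Group"
begin

section \<open>Functions as a real vector space\<close>

text \<open>The pointwise operations of Function_Algebras, extended by scalar multiplication, so that
  linear algebra is available for tangent vectors, which are functionals on smooth functions.\<close>

instantiation "fun" :: (type, real_vector) real_vector
begin

definition scaleR_fun :: "real \<Rightarrow> ('a \<Rightarrow> 'b) \<Rightarrow> 'a \<Rightarrow> 'b"
  where "scaleR_fun c f = (\<lambda>x. c *\<^sub>R f x)"

instance
  by standard (auto simp: scaleR_fun_def fun_eq_iff scaleR_add_right scaleR_add_left)

end

section \<open>Smooth manifolds and Lie groups\<close>

text \<open>These two notions are meant for open subsets of finite-dimensional spaces only.\<close>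

primrec Ck_on :: "nat \<Rightarrow> 'e::euclidean_space set \<Rightarrow> ('e \<Rightarrow> 'f::real_normed_vector) \<Rightarrow> bool"
where
  "Ck_on 0 S f \<longleftrightarrow> continuous_on S f"
| "Ck_on (Suc k) S f \<longleftrightarrow>
     (\<forall>x\<in>S. f differentiable (at x)) \<and> (\<forall>v. Ck_on k S (\<lambda>x. frechet_derivative f (at x) v))"

definition smooth_on :: "'e::euclidean_space set \<Rightarrow> ('e \<Rightarrow> 'f::real_normed_vector) \<Rightarrow> bool"
  where "smooth_on S f \<longleftrightarrow> (\<forall>k. Ck_on k S f)"

type_synonym ('a, 'e) atlas = "('a set \<times> ('a \<Rightarrow> 'e)) set"

definition is_chart :: "'a::topological_space set \<Rightarrow> ('a \<Rightarrow> 'e::euclidean_space) \<Rightarrow> bool"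
  where "is_chart U \<phi> \<longleftrightarrow> open U \<and> open (\<phi> ` U) \<and> (\<exists>\<psi>. homeomorphism U (\<phi> ` U) \<phi> \<psi>)"

text \<open>The atlas need not be maximal. Its model space \<open>'e\<close> fixes the dimension.\<close>

definition smooth_manifold ::
  "('a::{t2_space,second_countable_topology}, 'e::euclidean_space) atlas \<Rightarrow> bool"
  where "smooth_manifold A \<longleftrightarrow>
    (\<Union>(U, \<phi>)\<in>A. U) = UNIV \<and>
    (\<forall>(U, \<phi>)\<in>A. is_chart U \<phi>) \<and>
    (\<forall>(U, \<phi>)\<in>A. \<forall>(V, \<psi>)\<in>A. smooth_on (\<phi> ` (U \<inter> V)) (\<psi> \<circ> inv_into U \<phi>))"

definition smooth_map :: "('a::topological_space, 'e::euclidean_space) atlas \<Rightarrow>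
    ('b::topological_space, 'f::euclidean_space) atlas \<Rightarrow> ('a \<Rightarrow> 'b) \<Rightarrow> bool"
  where "smooth_map A B F \<longleftrightarrow>
    continuous_on UNIV F \<and>
    (\<forall>(U, \<phi>)\<in>A. \<forall>(V, \<psi>)\<in>B. smooth_on (\<phi> ` (U \<inter> F -` V)) (\<psi> \<circ> F \<circ> inv_into U \<phi>))"

definition prod_atlas :: "('a, 'e) atlas \<Rightarrow> ('b, 'f) atlas \<Rightarrow> ('a \<times> 'b, 'e \<times> 'f) atlas"
  where "prod_atlas A B = {(U \<times> V, map_prod \<phi> \<psi>) | U \<phi> V \<psi>. (U, \<phi>) \<in> A \<and> (V, \<psi>) \<in> B}"

definition smooth_funs :: "('a::topological_space, 'e::euclidean_space) atlas \<Rightarrow> ('a \<Rightarrow> real) set"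
  where "smooth_funs A = {f. smooth_map A {(UNIV, id)} f}"

definition lie_group :: "('a::{t2_space,second_countable_topology}) monoid \<Rightarrow>
    ('a, 'e::euclidean_space) atlas \<Rightarrow> bool"
  where "lie_group L A \<longleftrightarrow>
    group L \<and> carrier L = UNIV \<and> smooth_manifold A \<and>
    smooth_map (prod_atlas A A) A (\<lambda>(x, y). x \<otimes>\<^bsub>L\<^esub> y) \<and>
    smooth_map A A (\<lambda>x. inv\<^bsub>L\<^esub> x)"

section \<open>Tangent vectors and vector fields\<close>

text \<open>Tangent vectors at \<open>p\<close> are the derivations at \<open>p\<close> of the algebra of smooth functions.
  They are set to 0 on non-smooth functions, so that derivations agreeing on all smooth functions
  are equal.\<close>

type_synonym 'a tvec = "('a \<Rightarrow> real) \<Rightarrow> real"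
type_synonym 'a vfield = "'a \<Rightarrow> 'a tvec"

definition tangent_space ::
  "('a::topological_space, 'e::euclidean_space) atlas \<Rightarrow> 'a \<Rightarrow> 'a tvec set"
  where "tangent_space A p = {v.
    (\<forall>f\<in>smooth_funs A. \<forall>h\<in>smooth_funs A. \<forall>c. v (c *\<^sub>R f + h) = c * v f + v h) \<and>
    (\<forall>f\<in>smooth_funs A. \<forall>h\<in>smooth_funs A. v (f * h) = v f * h p + f p * v h) \<and>
    (\<forall>f. f \<notin> smooth_funs A \<longrightarrow> v f = 0)}"

definition vfield_app :: "'a vfield \<Rightarrow> ('a \<Rightarrow> real) \<Rightarrow> 'a \<Rightarrow> real"
  where "vfield_app X f = (\<lambda>p. X p f)"

definition vfields :: "('a::topological_space, 'e::euclidean_space) atlas \<Rightarrow> 'a vfield set"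
  where "vfields A = {X. (\<forall>p. X p \<in> tangent_space A p) \<and>
    (\<forall>f\<in>smooth_funs A. vfield_app X f \<in> smooth_funs A)}"

definition vfield_scale :: "('a \<Rightarrow> real) \<Rightarrow> 'a vfield \<Rightarrow> 'a vfield"
  where "vfield_scale f X = (\<lambda>p. f p *\<^sub>R X p)"

definition lie_bracket :: "'a vfield \<Rightarrow> 'a vfield \<Rightarrow> 'a vfield"
  where "lie_bracket X Y = (\<lambda>p f. X p (vfield_app Y f) - Y p (vfield_app X f))"

definition left_invariant :: "('a::topological_space) monoid \<Rightarrow>
    ('a, 'e::euclidean_space) atlas \<Rightarrow> 'a vfield \<Rightarrow> bool"
  where "left_invariant L A X \<longleftrightarrow> X \<in> vfields A \<and>
    (\<forall>p q. \<forall>f\<in>smooth_funs A. X (p \<otimes>\<^bsub>L\<^esub> q) f = X q (\<lambda>r. f (p \<otimes>\<^bsub>L\<^esub> r)))"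

text \<open>The Lie algebra of \<open>L\<close> is the tangent space at the identity with the bracket of
  left-invariant extensions; \<open>E i\<close> is the left-invariant field extending the basis vector
  \<open>e\<^sub>i\<close>.\<close>

definition has_lie_algebra_g45 :: "('a::{t2_space,second_countable_topology}) monoid \<Rightarrow>
    ('a, real^4) atlas \<Rightarrow> real \<Rightarrow> real \<Rightarrow> (4 \<Rightarrow> 'a vfield) \<Rightarrow> bool"
  where "has_lie_algebra_g45 L A a b E \<longleftrightarrow>
    (\<forall>i. left_invariant L A (E i)) \<and>
    inj (\<lambda>i. E i \<one>\<^bsub>L\<^esub>) \<and> independent (range (\<lambda>i. E i \<one>\<^bsub>L\<^esub>)) \<and>
    span (range (\<lambda>i. E i \<one>\<^bsub>L\<^esub>)) = tangent_space A \<one>\<^bsub>L\<^esub> \<and>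
    lie_bracket (E 1) (E 4) = E 1 \<and>
    lie_bracket (E 2) (E 4) = a *\<^sub>R E 2 \<and>
    lie_bracket (E 3) (E 4) = b *\<^sub>R E 3 \<and>
    lie_bracket (E 1) (E 2) = 0 \<and>
    lie_bracket (E 1) (E 3) = 0 \<and>
    lie_bracket (E 2) (E 3) = 0"

section \<open>Metrics, almost complex structures, Levi-Civita connections\<close>

text \<open>Tensors at a point are functions on all functionals of which only the values on the
  tangent space matter.\<close>

definition linear_over :: "'v::real_vector set \<Rightarrow> ('v \<Rightarrow> 'w::real_vector) \<Rightarrow> bool"
  where "linear_over V f \<longleftrightarrow> (\<forall>x\<in>V. \<forall>y\<in>V. \<forall>c. f (c *\<^sub>R x + y) = c *\<^sub>R f x + f y)"

type_synonym 'a metric_field = "'a \<Rightarrow> 'a tvec \<Rightarrow> 'a tvec \<Rightarrow> real"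
type_synonym 'a endo_field = "'a \<Rightarrow> 'a tvec \<Rightarrow> 'a tvec"
type_synonym 'a connection = "'a vfield \<Rightarrow> 'a vfield \<Rightarrow> 'a vfield"

definition pseudo_riemannian_metric ::
  "('a::topological_space, 'e::euclidean_space) atlas \<Rightarrow> 'a metric_field \<Rightarrow> bool"
  where "pseudo_riemannian_metric A g \<longleftrightarrow>
    (\<forall>p. \<forall>x\<in>tangent_space A p. linear_over (tangent_space A p) (g p x)) \<and>
    (\<forall>p. \<forall>x\<in>tangent_space A p. \<forall>y\<in>tangent_space A p. g p x y = g p y x) \<and>
    (\<forall>p. \<forall>x\<in>tangent_space A p. (\<forall>y\<in>tangent_space A p. g p x y = 0) \<longrightarrow> x = 0) \<and>
    (\<forall>X\<in>vfields A. \<forall>Y\<in>vfields A. (\<lambda>p. g p (X p) (Y p)) \<in> smooth_funs A)"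

definition endo_app :: "'a endo_field \<Rightarrow> 'a vfield \<Rightarrow> 'a vfield"
  where "endo_app J X = (\<lambda>p. J p (X p))"

definition almost_complex_structure ::
  "('a::topological_space, 'e::euclidean_space) atlas \<Rightarrow> 'a endo_field \<Rightarrow> bool"
  where "almost_complex_structure A J \<longleftrightarrow>
    (\<forall>p. linear_over (tangent_space A p) (J p)) \<and>
    (\<forall>p. \<forall>x\<in>tangent_space A p. J p x \<in> tangent_space A p \<and> J p (J p x) = - x) \<and>
    (\<forall>X\<in>vfields A. endo_app J X \<in> vfields A)"

definition affine_connection ::
  "('a::topological_space, 'e::euclidean_space) atlas \<Rightarrow> 'a connection \<Rightarrow> bool"
  where "affine_connection A D \<longleftrightarrow>
    (\<forall>X\<in>vfields A. \<forall>Y\<in>vfields A. D X Y \<in> vfields A) \<and>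
    (\<forall>f\<in>smooth_funs A. \<forall>X\<in>vfields A. \<forall>Y\<in>vfields A. \<forall>Z\<in>vfields A.
       D (vfield_scale f X + Y) Z = vfield_scale f (D X Z) + D Y Z) \<and>
    (\<forall>X\<in>vfields A. \<forall>Y\<in>vfields A. \<forall>Z\<in>vfields A. D X (Y + Z) = D X Y + D X Z) \<and>
    (\<forall>f\<in>smooth_funs A. \<forall>X\<in>vfields A. \<forall>Y\<in>vfields A.
       D X (vfield_scale f Y) = vfield_scale (vfield_app X f) Y + vfield_scale f (D X Y))"

definition levi_civita_connection :: "('a::topological_space, 'e::euclidean_space) atlas \<Rightarrow>
    'a metric_field \<Rightarrow> 'a connection \<Rightarrow> bool"
  where "levi_civita_connection A g D \<longleftrightarrow>
    affine_connection A D \<and>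
    (\<forall>X\<in>vfields A. \<forall>Y\<in>vfields A. D X Y - D Y X = lie_bracket X Y) \<and>
    (\<forall>X\<in>vfields A. \<forall>Y\<in>vfields A. \<forall>Z\<in>vfields A. \<forall>p.
       X p (\<lambda>q. g q (Y q) (Z q)) = g p (D X Y p) (Z p) + g p (Y p) (D X Z p))"

text \<open>The field \<open>p \<mapsto> g((\<nabla>\<^sub>X J)Y, Z)(p)\<close>.\<close>

definition fundamental_tensor :: "'a metric_field \<Rightarrow> 'a connection \<Rightarrow> 'a endo_field \<Rightarrow>
    'a vfield \<Rightarrow> 'a vfield \<Rightarrow> 'a vfield \<Rightarrow> 'a \<Rightarrow> real"
  where "fundamental_tensor g D J X Y Z =
    (\<lambda>p. g p ((D X (endo_app J Y) - endo_app J (D X Y)) p) (Z p))"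

text \<open>The structure \<open>(H, G)\<close>; the remaining metrics \<open>g\<^sub>\<alpha>(x, y) = g(J\<^sub>\<alpha> x, y)\<close> of \<open>G\<close> are
  determined by \<open>g\<close> and \<open>J\<^sub>\<alpha>\<close>. As \<open>E\<close> is a left-invariant frame, the constancy of
  the components below expresses left-invariance.\<close>

definition hermitian_norden_structure ::
  "('a::{t2_space,second_countable_topology}, real^4) atlas \<Rightarrow> (4 \<Rightarrow> 'a vfield) \<Rightarrow>
     'a endo_field \<Rightarrow> 'a endo_field \<Rightarrow> 'a endo_field \<Rightarrow> 'a metric_field \<Rightarrow> bool"
  where "hermitian_norden_structure A E J1 J2 J3 g \<longleftrightarrow>
    almost_complex_structure A J1 \<and> almost_complex_structure A J2 \<and>
    almost_complex_structure A J3 \<and> pseudo_riemannian_metric A g \<and>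
    endo_app J1 (E 1) = E 2 \<and> endo_app J1 (E 2) = - E 1 \<and>
    endo_app J1 (E 3) = - E 4 \<and> endo_app J1 (E 4) = E 3 \<and>
    endo_app J2 (E 1) = E 3 \<and> endo_app J2 (E 2) = E 4 \<and>
    endo_app J2 (E 3) = - E 1 \<and> endo_app J2 (E 4) = - E 2 \<and>
    endo_app J3 (E 1) = - E 4 \<and> endo_app J3 (E 2) = E 3 \<and>
    endo_app J3 (E 3) = - E 2 \<and> endo_app J3 (E 4) = E 1 \<and>
    (\<forall>p (x::real^4) (y::real^4).
       g p (\<Sum>i\<in>UNIV. (x $ i) *\<^sub>R E i p) (\<Sum>i\<in>UNIV. (y $ i) *\<^sub>R E i p) =
         x $ 1 * y $ 1 + x $ 2 * y $ 2 - x $ 3 * y $ 3 - x $ 4 * y $ 4)"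

section \<open>Classes of tensors in dimension 4\<close>

text \<open>In this section \<open>V\<close> is a 4-dimensional space with basis \<open>e\<close>, metric \<open>g\<close> and almost
  complex structure \<open>J\<close>; the classes do not depend on \<open>e\<close>.\<close>

type_synonym 'v tensor3 = "'v \<Rightarrow> 'v \<Rightarrow> 'v \<Rightarrow> real"

definition trilinear_over :: "'v::real_vector set \<Rightarrow> 'v tensor3 \<Rightarrow> bool"
  where "trilinear_over V F \<longleftrightarrow> (\<forall>x\<in>V. \<forall>y\<in>V.
    linear_over V (\<lambda>u. F u x y) \<and> linear_over V (\<lambda>u. F x u y) \<and> linear_over V (\<lambda>u. F x y u))"

definition cyclic_sum :: "'v tensor3 \<Rightarrow> 'v tensor3"
  where "cyclic_sum F x y z = F x y z + F y z x + F z x y"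

definition lee_form :: "('v \<Rightarrow> 'v \<Rightarrow> real) \<Rightarrow> (4 \<Rightarrow> 'v) \<Rightarrow> 'v tensor3 \<Rightarrow> 'v \<Rightarrow> real"
  where "lee_form g e F z =
    (\<Sum>k\<in>UNIV. \<Sum>l\<in>UNIV. matrix_inv (\<chi> i j. g (e i) (e j)) $ k $ l * F (e k) (e l) z)"

text \<open>\<open>\<epsilon> = 1\<close> is the Hermitian case, \<open>\<epsilon> = -1\<close> the Norden case.\<close>

definition fundamental_tensors :: "real \<Rightarrow> 'v::real_vector set \<Rightarrow> ('v \<Rightarrow> 'v) \<Rightarrow> 'v tensor3 set"
  where "fundamental_tensors \<epsilon> V J = {F. trilinear_over V F \<and>
    (\<forall>x\<in>V. \<forall>y\<in>V. \<forall>z\<in>V. F x y z = - \<epsilon> * F x z y \<and> F x y z = - \<epsilon> * F x (J y) (J z))}"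

definition hermitian_W2 :: "'v::real_vector set \<Rightarrow> ('v \<Rightarrow> 'v) \<Rightarrow> 'v tensor3 set"
  where "hermitian_W2 V J = {F \<in> fundamental_tensors 1 V J.
    \<forall>x\<in>V. \<forall>y\<in>V. \<forall>z\<in>V. cyclic_sum F x y z = 0}"

definition hermitian_W4 :: "'v::real_vector set \<Rightarrow> ('v \<Rightarrow> 'v \<Rightarrow> real) \<Rightarrow> (4 \<Rightarrow> 'v) \<Rightarrow>
    ('v \<Rightarrow> 'v) \<Rightarrow> 'v tensor3 set"
  where "hermitian_W4 V g e J = {F \<in> fundamental_tensors 1 V J.
    \<forall>x\<in>V. \<forall>y\<in>V. \<forall>z\<in>V. F x y z = 1/2 *
      (g x y * lee_form g e F z - g x (J y) * lee_form g e F (J z)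
       - g x z * lee_form g e F y + g x (J z) * lee_form g e F (J y))}"

definition norden_W1 :: "'v::real_vector set \<Rightarrow> ('v \<Rightarrow> 'v \<Rightarrow> real) \<Rightarrow> (4 \<Rightarrow> 'v) \<Rightarrow>
    ('v \<Rightarrow> 'v) \<Rightarrow> 'v tensor3 set"
  where "norden_W1 V g e J = {F \<in> fundamental_tensors (-1) V J.
    \<forall>x\<in>V. \<forall>y\<in>V. \<forall>z\<in>V. F x y z = 1/4 *
      (g x y * lee_form g e F z + g x (J y) * lee_form g e F (J z)
       + g x z * lee_form g e F y + g x (J z) * lee_form g e F (J y))}"

definition norden_W2 :: "'v::real_vector set \<Rightarrow> ('v \<Rightarrow> 'v \<Rightarrow> real) \<Rightarrow> (4 \<Rightarrow> 'v) \<Rightarrow>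
    ('v \<Rightarrow> 'v) \<Rightarrow> 'v tensor3 set"
  where "norden_W2 V g e J = {F \<in> fundamental_tensors (-1) V J.
    (\<forall>x\<in>V. \<forall>y\<in>V. \<forall>z\<in>V. cyclic_sum (\<lambda>x y z. F x y (J z)) x y z = 0) \<and>
    (\<forall>z\<in>V. lee_form g e F z = 0)}"

definition norden_W3 :: "'v::real_vector set \<Rightarrow> ('v \<Rightarrow> 'v) \<Rightarrow> 'v tensor3 set"
  where "norden_W3 V J = {F \<in> fundamental_tensors (-1) V J.
    \<forall>x\<in>V. \<forall>y\<in>V. \<forall>z\<in>V. cyclic_sum F x y z = 0}"

section \<open>Classes of manifolds\<close>

text \<open>\<open>C p\<close> is a space of tensors at \<open>p\<close>; being in a direct sum of classes means taking for
  \<open>C p\<close> the sum of the corresponding spaces.\<close>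

definition belongs_to :: "('a::topological_space, 'e::euclidean_space) atlas \<Rightarrow>
    'a metric_field \<Rightarrow> 'a connection \<Rightarrow> 'a endo_field \<Rightarrow> ('a \<Rightarrow> 'a tvec tensor3 set) \<Rightarrow> bool"
  where "belongs_to A g D J C \<longleftrightarrow> (\<forall>p. \<exists>T \<in> C p.
    \<forall>X\<in>vfields A. \<forall>Y\<in>vfields A. \<forall>Z\<in>vfields A.
      fundamental_tensor g D J X Y Z p = T (X p) (Y p) (Z p))"

end

theory Submission
  imports Defs
begin

text \<open>
  All data are left-invariant, so the classes can be read off from one tensor on a 4-dimensional space.
  The brackets say that \<open>e\<^sub>1, e\<^sub>2, e\<^sub>3\<close> commute and that \<open>S = [\<cdot>, e\<^sub>4]\<close> is the operator
  \<open>diag(1, a, b, 0)\<close>, which is self-adjoint for \<open>g\<close>. Koszul's formula then collapses to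
  \<open>\<Gamma>(x, y, z) = g(\<nabla>\<^sub>x y, z) = g(S x, y) g(z, e\<^sub>4) - g(S x, z) g(y, e\<^sub>4)\<close>, and
  \<open>F(x, y, z) = \<Gamma>(x, J y, z) + \<epsilon> \<Gamma>(x, y, J z)\<close> for each of the three structures
  (\<open>koszul_form\<close>, \<open>structure_tensor\<close>). In coordinates this is an explicit tensor, affine in
  \<open>a\<close> and \<open>b\<close>.

  Two algebraic facts translate the classes into the vanishing of simple quantities. In the Hermitian case
  in dimension 4, a fundamental tensor with vanishing Lee form has vanishing cyclic sum, because the cyclic
  sum is a 3-form whose components are traces (\<open>lee_zero_imp_cyclic_sum_zero\<close>). So \<open>F\<close> minus its Lee part
  is in \<open>W\<^sub>2\<close>, and \<open>W\<^sub>2 \<oplus> W\<^sub>4\<close> is everything. In the Norden case \<open>F\<close> is the sum of a Lee part in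
  \<open>W\<^sub>1\<close>, of a part in \<open>W\<^sub>3\<close> built from the 3-form \<open>\<omega>\<close> that is the cyclic sum of \<open>F(x, y, J z)\<close>,
  and of a rest in \<open>W\<^sub>2\<close> (\<open>norden_W1_W2_W3\<close>); the first part is absent when the Lee form vanishes and
  the second when \<open>\<omega>\<close> vanishes. The three Lee forms are \<open>(1 + a) z\<^sup>3\<close>, \<open>(1 + 2 a + b) z\<^sup>2\<close> and
  \<open>- (2 + a + b) z\<^sup>1\<close>, and \<open>\<omega>\<close> vanishes for the second structure if \<open>b = 1\<close> and for the third if
  \<open>a = b\<close>. All rows follow from this, up to two cases in which \<open>F\<close> equals its Lee part:
  \<open>a = 1\<close> for the first structure, and \<open>a = b = 1\<close> for the second.

  It remains to pass from vector fields to this algebra. The frame is only known to span the tangent space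
  at the identity. Tangent vectors are derivations, and they are transported to other points by left
  translations, which act on smooth functions because compositions of smooth maps are smooth
  (\<open>left_invariant_frame_spans\<close>). For arbitrary fields, metric compatibility gives
  \<open>g(\<nabla>\<^sub>X Y, E\<^sub>k) = X(g(Y, E\<^sub>k)) + \<Gamma>(X, Y, E\<^sub>k)\<close>, and the derivative terms cancel in
  \<open>F\<close> because \<open>J\<close> has constant coefficients in the frame (\<open>fundamental_tensor_frame\<close>).
\<close>

section \<open>Calculus of maps of class \<open>C\<^sup>k\<close>\<close>

text \<open>Charts provide formulas for a map on open sets only. As derivatives at a point of an open set depend only
  on the values there, such a formula can replace the map.\<close>

lemma frechet_derivative_cong_open:
  assumes "open S" "x \<in> S" "\<And>y. y \<in> S \<Longrightarrow> f y = g y"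
  shows "frechet_derivative f (at x) = frechet_derivative g (at x)"
proof -
  have "(f has_derivative D) (at x) \<longleftrightarrow> (g has_derivative D) (at x)" for D
    using has_derivative_transform_within_open[of f D x UNIV S g, OF _ assms(1,2)]
      has_derivative_transform_within_open[of g D x UNIV S f, OF _ assms(1,2)] assms(3) by metis
  then show ?thesis by (simp add: frechet_derivative_def)
qed

lemma Ck_on_cong:
  assumes "open S" "\<And>y. y \<in> S \<Longrightarrow> f y = g y"
  shows "Ck_on k S f \<Longrightarrow> Ck_on k S g"
  using assms(2)
proof (induction k arbitrary: f g)
  case 0
  then show ?case using continuous_on_cong[of S S f g] by simp
next
  case (Suc k)
  have "g differentiable (at x)" if "x \<in> S" for x
  proof -
    have "f differentiable (at x)" using Suc.prems that by simp
    then show ?thesis unfolding differentiable_def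
      using has_derivative_transform_within_open[OF _ assms(1) that] Suc.prems(2) by blast
  qed
  moreover have "Ck_on k S (\<lambda>x. frechet_derivative g (at x) v)" for v
  proof (rule Suc.IH)
    show "Ck_on k S (\<lambda>x. frechet_derivative f (at x) v)" using Suc.prems by simp
    show "frechet_derivative f (at y) v = frechet_derivative g (at y) v" if "y \<in> S" for y
      using frechet_derivative_cong_open[OF assms(1) that, of f g] Suc.prems(2) by simp
  qed
  ultimately show ?case by simp
qed

text \<open>Inductive proofs compute a derivative by the rules of differentiation; this rule accepts that
  formula in place of the derivative chosen by the operator \<open>frechet_derivative\<close>.\<close>

lemma Ck_on_SucI:
  assumes "open S" "\<And>x. x \<in> S \<Longrightarrow> (f has_derivative D x) (at x)" "\<And>v. Ck_on k S (\<lambda>x. D x v)"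
  shows "Ck_on (Suc k) S f"
proof -
  have "Ck_on k S (\<lambda>x. frechet_derivative f (at x) v)" for v
    by (rule Ck_on_cong[OF assms(1) _ assms(3)]) (simp add: frechet_derivative_at[OF assms(2), symmetric])
  then show ?thesis using assms(2) by (auto simp: differentiable_def)
qed

lemma Ck_on_Suc_has_derivative:
  assumes "Ck_on (Suc k) S f" "x \<in> S"
  shows "(f has_derivative frechet_derivative f (at x)) (at x)"
  using assms by (simp add: frechet_derivative_works)

lemma Ck_on_Suc_imp_Ck_on: "Ck_on (Suc k) S f \<Longrightarrow> Ck_on k S f"
proof (induction k arbitrary: f)
  case 0
  then show ?case
    by (auto intro!: continuous_at_imp_continuous_on differentiable_imp_continuous_within)
next
  case (Suc k)
  then show ?case by simp
qed

lemma Ck_on_const: "Ck_on k S (\<lambda>x. c)"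
  by (induction k arbitrary: c) simp_all

lemma Ck_on_add:
  "open S \<Longrightarrow> Ck_on k S f \<Longrightarrow> Ck_on k S g \<Longrightarrow> Ck_on k S (\<lambda>x. f x + g x)"
proof (induction k arbitrary: f g)
  case 0
  then show ?case by (simp add: continuous_on_add)
next
  case (Suc k)
  show ?case
  proof (rule Ck_on_SucI[OF Suc.prems(1)])
    show "((\<lambda>x. f x + g x) has_derivative
       (\<lambda>v. frechet_derivative f (at x) v + frechet_derivative g (at x) v)) (at x)" if "x \<in> S" for x
      using Suc.prems that by (intro has_derivative_add Ck_on_Suc_has_derivative)
    show "Ck_on k S (\<lambda>x. frechet_derivative f (at x) v + frechet_derivative g (at x) v)" for v
      using Suc.prems by (intro Suc.IH) simp_all
  qed
qed

lemma Ck_on_sum: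
  "finite I \<Longrightarrow> open S \<Longrightarrow> (\<And>i. i \<in> I \<Longrightarrow> Ck_on k S (f i)) \<Longrightarrow> Ck_on k S (\<lambda>x. \<Sum>i\<in>I. f i x)"
  by (induction I rule: finite_induct) (auto intro: Ck_on_add Ck_on_const)

lemma Ck_on_bounded_linear:
  assumes "bounded_linear L" "open S"
  shows "Ck_on k S f \<Longrightarrow> Ck_on k S (\<lambda>x. L (f x))"
proof (induction k arbitrary: f)
  case 0
  then show ?case using assms(1) by (simp add: bounded_linear.continuous_on)
next
  case (Suc k)
  show ?case
  proof (rule Ck_on_SucI[OF assms(2)])
    show "((\<lambda>x. L (f x)) has_derivative (\<lambda>v. L (frechet_derivative f (at x) v))) (at x)" if "x \<in> S" for x
      using bounded_linear.has_derivative[OF assms(1) Ck_on_Suc_has_derivative[OF Suc.prems that]] .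
    show "Ck_on k S (\<lambda>x. L (frechet_derivative f (at x) v))" for v
      using Suc by simp
  qed
qed

lemma Ck_on_scaleR:
  fixes f :: "'e::euclidean_space \<Rightarrow> real" and g :: "'e \<Rightarrow> 'f::real_normed_vector"
  shows "open S \<Longrightarrow> Ck_on k S f \<Longrightarrow> Ck_on k S g \<Longrightarrow> Ck_on k S (\<lambda>x. f x *\<^sub>R g x)"
proof (induction k arbitrary: f g)
  case 0
  then show ?case by (simp add: continuous_on_scaleR)
next
  case (Suc k)
  show ?case
  proof (rule Ck_on_SucI[OF Suc.prems(1)])
    show "((\<lambda>x. f x *\<^sub>R g x) has_derivative (\<lambda>v. f x *\<^sub>R frechet_derivative g (at x) v
        + frechet_derivative f (at x) v *\<^sub>R g x)) (at x)" if "x \<in> S" for x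
      using Suc.prems that by (intro has_derivative_scaleR Ck_on_Suc_has_derivative)
    show "Ck_on k S (\<lambda>x. f x *\<^sub>R frechet_derivative g (at x) v
        + frechet_derivative f (at x) v *\<^sub>R g x)" for v
    proof (intro Ck_on_add Suc.IH)
      show "Ck_on k S f" "Ck_on k S g"
        using Suc.prems Ck_on_Suc_imp_Ck_on by blast+
    qed (use Suc.prems in simp_all)
  qed
qed

text \<open>By induction on the order. The derivative \<open>Dg(f x)(Df x v)\<close> is not a composition with \<open>f\<close>,
  because its argument varies with \<open>x\<close>; expanding \<open>Df x v\<close> in a basis writes it as a sum of products
  of a component of \<open>Df x v\<close> with a composition \<open>Dg(f x) b\<close>, to which the induction hypothesis applies.\<close>

lemma Ck_on_compose:
  fixes f :: "'e::euclidean_space \<Rightarrow> 'f::euclidean_space" and g :: "'f \<Rightarrow> 'g::real_normed_vector"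
  assumes "open S" "open T" "f ` S \<subseteq> T"
  shows "Ck_on k S f \<Longrightarrow> Ck_on k T g \<Longrightarrow> Ck_on k S (g \<circ> f)"
proof (induction k arbitrary: g)
  case 0
  then show ?case using assms(3) by (auto intro: continuous_on_compose2)
next
  case (Suc k)
  let ?f' = "\<lambda>x. frechet_derivative f (at x)" and ?g' = "\<lambda>y. frechet_derivative g (at y)"
  have g': "(g has_derivative ?g' (f x)) (at (f x))" if "x \<in> S" for x
    using that assms(3) Suc.prems by (intro Ck_on_Suc_has_derivative) auto
  show ?case
  proof (rule Ck_on_SucI[OF assms(1)])
    show "(g \<circ> f has_derivative (\<lambda>v. \<Sum>b\<in>Basis. (?f' x v \<bullet> b) *\<^sub>R ?g' (f x) b)) (at x)"
      if x: "x \<in> S" for x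
    proof -
      have "(g \<circ> f has_derivative ?g' (f x) \<circ> ?f' x) (at x)"
        using Ck_on_Suc_has_derivative[OF Suc.prems(1) x] g'[OF x] by (rule diff_chain_at)
      moreover have "?g' (f x) w = (\<Sum>b\<in>Basis. (w \<bullet> b) *\<^sub>R ?g' (f x) b)" for w
      proof -
        have "linear (?g' (f x))" using g'[OF x] has_derivative_linear by blast
        have "?g' (f x) (\<Sum>b\<in>Basis. (w \<bullet> b) *\<^sub>R b) = (\<Sum>b\<in>Basis. (w \<bullet> b) *\<^sub>R ?g' (f x) b)"
          unfolding linear_sum[OF \<open>linear (?g' (f x))\<close>] linear_cmul[OF \<open>linear (?g' (f x))\<close>] ..
        then show ?thesis unfolding euclidean_representation .
      qed
      then have "?g' (f x) \<circ> ?f' x = (\<lambda>v. \<Sum>b\<in>Basis. (?f' x v \<bullet> b) *\<^sub>R ?g' (f x) b)"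
        unfolding comp_def by (intro ext)
      ultimately show ?thesis by simp
    qed
    show "Ck_on k S (\<lambda>x. \<Sum>b\<in>Basis. (?f' x v \<bullet> b) *\<^sub>R ?g' (f x) b)" for v
    proof (intro Ck_on_sum Ck_on_scaleR finite_Basis assms(1))
      fix b :: 'f
      show "Ck_on k S (\<lambda>x. ?f' x v \<bullet> b)"
        using Suc.prems(1) by (intro Ck_on_bounded_linear[OF bounded_linear_inner_left assms(1)]) simp
      show "Ck_on k S (\<lambda>x. ?g' (f x) b)"
        using Suc.IH[of "\<lambda>y. ?g' y b"] Suc.prems Ck_on_Suc_imp_Ck_on[OF Suc.prems(1)]
        by (simp add: comp_def)
    qed
  qed
qed

lemma Ck_on_local:
  assumes "open S" and "\<And>x. x \<in> S \<Longrightarrow> \<exists>N. open N \<and> x \<in> N \<and> Ck_on k N f"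
  shows "Ck_on k S f"
  using assms(2)
proof (induction k arbitrary: f)
  case 0
  have "isCont f x" if "x \<in> S" for x
    using 0[OF that] continuous_on_eq_continuous_at by auto
  then show ?case by (simp add: continuous_at_imp_continuous_on)
next
  case (Suc k)
  show ?case
  proof (simp, intro conjI ballI allI)
    show "f differentiable (at x)" if "x \<in> S" for x
      using Suc.prems[OF that] by auto
    show "Ck_on k S (\<lambda>x. frechet_derivative f (at x) v)" for v
    proof (rule Suc.IH)
      fix x assume "x \<in> S"
      from Suc.prems[OF this] show "\<exists>N. open N \<and> x \<in> N \<and> Ck_on k N (\<lambda>x. frechet_derivative f (at x) v)"
        by auto
    qed
  qed
qed

lemma Ck_on_Pair: "open S \<Longrightarrow> Ck_on k S (\<lambda>y. (c, y))"
proof (cases k)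
  case (Suc m)
  assume "open S"
  then show ?thesis unfolding Suc
  proof (rule Ck_on_SucI)
    show "((\<lambda>y. (c, y)) has_derivative (\<lambda>v. (0, v))) (at x)" for x
      by (auto intro!: derivative_eq_intros)
  qed (rule Ck_on_const)
qed (auto intro!: continuous_intros)

section \<open>Smooth functions and left translations\<close>

lemma chart_image_open:
  assumes "is_chart U \<phi>" "open W"
  shows "open (\<phi> ` (U \<inter> W))"
proof -
  obtain \<psi> where h: "homeomorphism U (\<phi> ` U) \<phi> \<psi>" and o: "open U" "open (\<phi> ` U)"
    using assms(1) unfolding is_chart_def by blast
  have "openin (top_of_set U) (U \<inter> W)" using assms(2) by (simp add: openin_open_Int)
  from homeomorphism_imp_open_map[OF h this] show ?thesis
    using o(2) openin_open_eq by blast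
qed

lemma chart_inj_on:
  assumes "is_chart U \<phi>"
  shows "inj_on \<phi> U"
  using assms unfolding is_chart_def homeomorphism_def by (metis inj_on_inverseI)

lemma manifold_chart_at:
  assumes "smooth_manifold A"
  obtains U \<phi> where "(U, \<phi>) \<in> A" "is_chart U \<phi>" "p \<in> U"
proof -
  have "p \<in> (\<Union>(U, \<phi>)\<in>A. U)" using assms by (simp add: smooth_manifold_def)
  then show ?thesis using that assms unfolding smooth_manifold_def by fast
qed

lemma manifold_is_chart: "smooth_manifold A \<Longrightarrow> (U, \<phi>) \<in> A \<Longrightarrow> is_chart U \<phi>"
  unfolding smooth_manifold_def by fast

lemma smooth_funs_iff:
  "f \<in> smooth_funs A \<longleftrightarrow> continuous_on UNIV f \<and>
     (\<forall>(U, \<phi>)\<in>A. \<forall>k. Ck_on k (\<phi> ` U) (\<lambda>y. f (inv_into U \<phi> y)))"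
  by (auto simp: smooth_funs_def smooth_map_def smooth_on_def comp_def)

lemma smooth_funsI:
  assumes "continuous_on UNIV f"
    and "\<And>U \<phi> k. (U, \<phi>) \<in> A \<Longrightarrow> Ck_on k (\<phi> ` U) (\<lambda>y. f (inv_into U \<phi> y))"
  shows "f \<in> smooth_funs A"
  using assms by (auto simp: smooth_funs_iff)

lemma smooth_funsD:
  assumes "f \<in> smooth_funs A"
  shows "continuous_on UNIV f"
    and "(U, \<phi>) \<in> A \<Longrightarrow> Ck_on k (\<phi> ` U) (\<lambda>y. f (inv_into U \<phi> y))"
  using assms by (auto simp: smooth_funs_iff)

lemma manifold_chart_open:
  assumes "smooth_manifold A" "(U, \<phi>) \<in> A"
  shows "open U" "open (\<phi> ` U)"
  using manifold_is_chart[OF assms] by (auto simp: is_chart_def)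

lemma smooth_funs_const: "(\<lambda>p. c) \<in> smooth_funs A"
  by (intro smooth_funsI Ck_on_const) simp

lemma smooth_funs_add:
  assumes "smooth_manifold A" "f \<in> smooth_funs A" "h \<in> smooth_funs A"
  shows "(\<lambda>p. f p + h p) \<in> smooth_funs A"
proof (rule smooth_funsI)
  show "continuous_on UNIV (\<lambda>p. f p + h p)"
    by (rule continuous_on_add[OF smooth_funsD(1)[OF assms(2)] smooth_funsD(1)[OF assms(3)]])
  show "Ck_on k (\<phi> ` U) (\<lambda>y. f (inv_into U \<phi> y) + h (inv_into U \<phi> y))" if "(U, \<phi>) \<in> A" for U \<phi> k
    by (rule Ck_on_add[OF manifold_chart_open(2)[OF assms(1) that]
        smooth_funsD(2)[OF assms(2) that] smooth_funsD(2)[OF assms(3) that]])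
qed

lemma smooth_funs_mult:
  assumes "smooth_manifold A" "f \<in> smooth_funs A" "h \<in> smooth_funs A"
  shows "(\<lambda>p. f p * h p) \<in> smooth_funs A"
proof (rule smooth_funsI)
  show "continuous_on UNIV (\<lambda>p. f p * h p)"
    by (rule continuous_on_mult[OF smooth_funsD(1)[OF assms(2)] smooth_funsD(1)[OF assms(3)]])
  show "Ck_on k (\<phi> ` U) (\<lambda>y. f (inv_into U \<phi> y) * h (inv_into U \<phi> y))" if "(U, \<phi>) \<in> A" for U \<phi> k
    using Ck_on_scaleR[OF manifold_chart_open(2)[OF assms(1) that]
        smooth_funsD(2)[OF assms(2) that] smooth_funsD(2)[OF assms(3) that]] by simp
qed

lemma is_chart_prod:
  assumes "is_chart V \<psi>" "is_chart U \<phi>"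
  shows "is_chart (V \<times> U) (map_prod \<psi> \<phi>)"
proof -
  obtain \<psi>' \<phi>' where h: "homeomorphism V (\<psi> ` V) \<psi> \<psi>'" "homeomorphism U (\<phi> ` U) \<phi> \<phi>'"
    and o: "open U" "open V" "open (\<phi> ` U)" "open (\<psi> ` V)"
    using assms unfolding is_chart_def by blast
  have im: "map_prod \<psi> \<phi> ` (V \<times> U) = \<psi> ` V \<times> \<phi> ` U" by (rule map_prod_surj_on) auto
  have cont: "continuous_on (V \<times> U) (map_prod \<psi> \<phi>)"
      "continuous_on (\<psi> ` V \<times> \<phi> ` U) (map_prod \<psi>' \<phi>')"
    using h unfolding homeomorphism_def map_prod_def case_prod_unfold
    by (auto intro!: continuous_on_Pair continuous_on_compose2[OF _ continuous_on_fst]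
        continuous_on_compose2[OF _ continuous_on_snd] continuous_on_id)
  have "homeomorphism (V \<times> U) (\<psi> ` V \<times> \<phi> ` U) (map_prod \<psi> \<phi>) (map_prod \<psi>' \<phi>')"
    using cont h by (intro homeomorphismI) (auto simp: homeomorphism_def)
  then show ?thesis unfolding is_chart_def im using o by (auto intro: open_Times)
qed

text \<open>Near a point \<open>q\<close> the translate \<open>f \<circ> (p \<otimes> \<cdot>)\<close> is, in charts around \<open>p\<close>, \<open>q\<close> and
  \<open>p \<otimes> q\<close>, the composition of three smooth maps: the insertion of the coordinates of \<open>p\<close>, the
  multiplication, and \<open>f\<close>. These charts only cover a neighbourhood of \<open>q\<close>, which suffices because
  smoothness is local.\<close>

lemma smooth_funs_left_translate:
  assumes "lie_group L A" "f \<in> smooth_funs A"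
  shows "(\<lambda>r. f (p \<otimes>\<^bsub>L\<^esub> r)) \<in> smooth_funs A"
proof (rule smooth_funsI)
  define mul where "mul = (\<lambda>(x, y). x \<otimes>\<^bsub>L\<^esub> y)"
  have mul: "mul (x, y) = x \<otimes>\<^bsub>L\<^esub> y" for x y by (simp add: mul_def)
  have M: "smooth_manifold A" and m: "smooth_map (prod_atlas A A) A mul"
    using assms(1) by (auto simp: lie_group_def mul_def)
  have mc: "continuous_on UNIV mul" using m by (simp add: smooth_map_def)
  have "continuous_on UNIV (\<lambda>r. f (mul (p, r)))"
    by (intro continuous_on_compose2[OF smooth_funsD(1)[OF assms(2)]]
        continuous_on_compose2[OF mc]) (auto intro!: continuous_intros)
  then show "continuous_on UNIV (\<lambda>r. f (p \<otimes>\<^bsub>L\<^esub> r))" by (simp add: mul)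
  fix U \<phi> k assume U: "(U, \<phi>) \<in> A"
  show "Ck_on k (\<phi> ` U) (\<lambda>y. f (p \<otimes>\<^bsub>L\<^esub> inv_into U \<phi> y))"
  proof (rule Ck_on_local)
    show "open (\<phi> ` U)" using manifold_chart_open[OF M U] by simp
    fix y0 assume "y0 \<in> \<phi> ` U"
    then obtain q where q: "q \<in> U" "y0 = \<phi> q" by blast
    obtain V \<psi> where V: "(V, \<psi>) \<in> A" "is_chart V \<psi>" "p \<in> V" using manifold_chart_at[OF M] .
    obtain W \<eta> where W: "(W, \<eta>) \<in> A" "is_chart W \<eta>" "p \<otimes>\<^bsub>L\<^esub> q \<in> W" using manifold_chart_at[OF M] .
    have Uc: "is_chart U \<phi>" using manifold_is_chart[OF M U] .
    \<comment> \<open>\<open>B\<close> is the part of the product chart that the multiplication sends into \<open>W\<close>,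
      and \<open>N\<close> is its slice over \<open>p\<close>.\<close>
    define B where "B = map_prod \<psi> \<phi> ` ((V \<times> U) \<inter> mul -` W)"
    define N where "N = (\<lambda>y. (\<psi> p, y)) -` B"
    have "open (mul -` W)" using mc W(2) by (auto simp: is_chart_def intro: open_vimage)
    then have B: "open B" unfolding B_def by (rule chart_image_open[OF is_chart_prod[OF V(2) Uc]])
    then have N: "open N" unfolding N_def by (intro open_vimage) (auto intro!: continuous_intros)
    have y0: "y0 \<in> N" using V W q by (force simp: N_def B_def mul)
    have iv: "inv_into (V \<times> U) (map_prod \<psi> \<phi>) (\<psi> p, \<phi> r) = (p, r)" if "r \<in> U" for r
      using inv_into_f_f[OF chart_inj_on[OF is_chart_prod[OF V(2) Uc]], of "(p, r)"] that V(3) by simp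
    have Nr: "\<exists>r\<in>U. y = \<phi> r \<and> p \<otimes>\<^bsub>L\<^esub> r \<in> W" if "y \<in> N" for y
      using that V(3) unfolding N_def B_def
      by (auto simp: mul inj_on_eq_iff[OF chart_inj_on[OF V(2)] V(3)])
    have "(V \<times> U, map_prod \<psi> \<phi>) \<in> prod_atlas A A" using V(1) U by (auto simp: prod_atlas_def)
    then have mult: "Ck_on k B (\<eta> \<circ> mul \<circ> inv_into (V \<times> U) (map_prod \<psi> \<phi>))" (is "Ck_on k B ?h")
      using m W(1) unfolding smooth_map_def smooth_on_def B_def by fast
    have "?h ` B \<subseteq> \<eta> ` W"
    proof
      fix z assume "z \<in> ?h ` B"
      then obtain w where w: "z = ?h w" "w \<in> B" by (rule imageE)
      from w(2) obtain x where x: "w = map_prod \<psi> \<phi> x" "x \<in> (V \<times> U) \<inter> mul -` W"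
        unfolding B_def by (rule imageE)
      from x w(1) have "z = \<eta> (mul x)"
        using inv_into_f_f[OF chart_inj_on[OF is_chart_prod[OF V(2) Uc]], of x] by simp
      then show "z \<in> \<eta> ` W" using x by auto
    qed
    then have "Ck_on k B ((\<lambda>y. f (inv_into W \<eta> y)) \<circ> ?h)"
      using B manifold_chart_open[OF M W(1)] smooth_funsD(2)[OF assms(2) W(1)] mult
      by (intro Ck_on_compose[of B "\<eta> ` W"])
    then have "Ck_on k N (((\<lambda>y. f (inv_into W \<eta> y)) \<circ> ?h) \<circ> (\<lambda>y. (\<psi> p, y)))"
      using B N by (intro Ck_on_compose[of N B] Ck_on_Pair) (auto simp: N_def)
    then have "Ck_on k N (\<lambda>y. f (p \<otimes>\<^bsub>L\<^esub> inv_into U \<phi> y))"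
    proof (rule Ck_on_cong[OF N, rotated])
      fix y assume "y \<in> N"
      then obtain r where r: "r \<in> U" "y = \<phi> r" "p \<otimes>\<^bsub>L\<^esub> r \<in> W" using Nr by blast
      then show "(((\<lambda>y. f (inv_into W \<eta> y)) \<circ> ?h) \<circ> (\<lambda>y. (\<psi> p, y))) y = f (p \<otimes>\<^bsub>L\<^esub> inv_into U \<phi> y)"
        using iv[OF r(1)] inv_into_f_f[OF chart_inj_on[OF W(2)] r(3)]
          inv_into_f_f[OF chart_inj_on[OF Uc] r(1)] by (simp add: mul)
    qed
    then show "\<exists>N. open N \<and> y0 \<in> N \<and> Ck_on k N (\<lambda>y. f (p \<otimes>\<^bsub>L\<^esub> inv_into U \<phi> y))"
      using N y0 by blast
  qed
qed

section \<open>Tangent vectors and vector fields\<close>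

lemma tangent_space_iff:
  "v \<in> tangent_space A p \<longleftrightarrow>
    (\<forall>f\<in>smooth_funs A. \<forall>h\<in>smooth_funs A. \<forall>c. v (\<lambda>q. c * f q + h q) = c * v f + v h) \<and>
    (\<forall>f\<in>smooth_funs A. \<forall>h\<in>smooth_funs A. v (\<lambda>q. f q * h q) = v f * h p + f p * v h) \<and>
    (\<forall>f. f \<notin> smooth_funs A \<longrightarrow> v f = 0)"
  unfolding tangent_space_def mem_Collect_eq plus_fun_def times_fun_def scaleR_fun_def
    real_scaleR_def ..

lemma subspace_tangent_space: "subspace (tangent_space A p)"
proof (rule subspaceI)
  show "0 \<in> tangent_space A p" by (simp add: tangent_space_iff)
  show "x + y \<in> tangent_space A p" if "x \<in> tangent_space A p" "y \<in> tangent_space A p" for x y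
    using that unfolding tangent_space_iff by (simp add: algebra_simps)
  show "c *\<^sub>R x \<in> tangent_space A p" if "x \<in> tangent_space A p" for c x
    using that unfolding tangent_space_iff by (simp add: algebra_simps scaleR_fun_def)
qed

lemma tangent_vector_const:
  assumes "v \<in> tangent_space A p"
  shows "v (\<lambda>q. c) = 0"
proof -
  have lin: "v (\<lambda>q. c * f q + h q) = c * v f + v h"
    and leibniz: "v (\<lambda>q. f q * h q) = v f * h p + f p * v h"
    if "f \<in> smooth_funs A" "h \<in> smooth_funs A" for f h c
    using assms that unfolding tangent_space_iff by auto
  have "v (\<lambda>q. 1) = 0"
    using leibniz[of "\<lambda>q. 1" "\<lambda>q. 1"] by (simp add: smooth_funs_const)
  moreover have "v (\<lambda>q. 0) = 0"
    using lin[of "\<lambda>q. 0" "\<lambda>q. 0" 1] by (simp add: smooth_funs_const)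
  ultimately show ?thesis
    using lin[of "\<lambda>q. 1" "\<lambda>q. 0" c] by (simp add: smooth_funs_const)
qed

lemma tangent_vector_cmult:
  assumes "v \<in> tangent_space A p" "f \<in> smooth_funs A"
  shows "v (\<lambda>q. c * f q) = c * v f"
proof -
  have "v (\<lambda>q. c * f q + 0) = c * v f + v (\<lambda>q. 0)"
    using assms smooth_funs_const[of 0 A] unfolding tangent_space_iff by fast
  then show ?thesis using tangent_vector_const[OF assms(1), of 0] by simp
qed

lemma vfields_tangent: "X \<in> vfields A \<Longrightarrow> X p \<in> tangent_space A p"
  by (simp add: vfields_def)

lemma vfields_zero: "0 \<in> vfields A"
  by (auto simp: vfields_def vfield_app_def smooth_funs_const subspace_0[OF subspace_tangent_space])

lemma vfields_add:
  assumes "smooth_manifold A" "X \<in> vfields A" "Y \<in> vfields A"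
  shows "X + Y \<in> vfields A"
  using assms smooth_funs_add[OF assms(1)]
  by (auto simp: vfields_def vfield_app_def subspace_add[OF subspace_tangent_space])

lemma vfields_scale:
  assumes "smooth_manifold A" "f \<in> smooth_funs A" "X \<in> vfields A"
  shows "vfield_scale f X \<in> vfields A"
  unfolding vfields_def mem_Collect_eq
proof (intro conjI allI ballI)
  show "vfield_scale f X p \<in> tangent_space A p" for p
    unfolding vfield_scale_def
    by (rule subspace_scale[OF subspace_tangent_space vfields_tangent[OF assms(3)]])
  show "vfield_app (vfield_scale f X) h \<in> smooth_funs A" if "h \<in> smooth_funs A" for h
  proof -
    have "vfield_app (vfield_scale f X) h = (\<lambda>p. f p * vfield_app X h p)"
      by (simp add: vfield_app_def vfield_scale_def scaleR_fun_def)
    then show ?thesis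
      using smooth_funs_mult[OF assms(1,2)] assms(3) that by (simp add: vfields_def)
  qed
qed

lemma vfields_sum:
  assumes "smooth_manifold A" "finite I" "\<And>i. i \<in> I \<Longrightarrow> X i \<in> vfields A"
  shows "(\<Sum>i\<in>I. X i) \<in> vfields A"
  using assms(2,3) by (induction I rule: finite_induct) (auto intro: vfields_add[OF assms(1)] vfields_zero)

text \<open>A connection is tensorial in its direction. With the functions \<open>f i\<close> as coefficients of a field in a
  frame, this reduces the derivative along an arbitrary field to those along the frame.\<close>

lemma connection_sum_left:
  assumes M: "smooth_manifold A" and D: "affine_connection A D" and Z: "Z \<in> vfields A"
    and "finite I" and "\<And>i. i \<in> I \<Longrightarrow> f i \<in> smooth_funs A" and "\<And>i. i \<in> I \<Longrightarrow> X i \<in> vfields A"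
  shows "D (\<Sum>i\<in>I. vfield_scale (f i) (X i)) Z = (\<Sum>i\<in>I. vfield_scale (f i) (D (X i) Z))"
  using assms(4-6)
proof (induction I rule: finite_induct)
  case empty
  have "D (vfield_scale (\<lambda>p. - 1) 0 + 0) Z = vfield_scale (\<lambda>p. - 1) (D 0 Z) + D 0 Z"
    using D Z vfields_zero[of A] smooth_funs_const[of "-1" A] unfolding affine_connection_def by blast
  then show ?case
    by (simp add: vfield_scale_def fun_eq_iff scaleR_fun_def)
next
  case (insert i I)
  let ?S = "\<Sum>i\<in>I. vfield_scale (f i) (X i)"
  have "?S \<in> vfields A"
    using insert.prems insert.hyps by (intro vfields_sum[OF M] vfields_scale[OF M]) auto
  then have "D (vfield_scale (f i) (X i) + ?S) Z = vfield_scale (f i) (D (X i) Z) + D ?S Z"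
    using D Z insert.prems unfolding affine_connection_def by blast
  moreover have "D ?S Z = (\<Sum>i\<in>I. vfield_scale (f i) (D (X i) Z))"
    using insert by simp
  ultimately show ?case by (simp only: sum.insert[OF insert.hyps])
qed

lemma span_range_imp_sum:
  fixes F :: "'i::finite \<Rightarrow> 'v::real_vector"
  assumes "v \<in> span (range F)"
  shows "\<exists>c. v = (\<Sum>i\<in>UNIV. c i *\<^sub>R F i)"
  using assms
proof (induction rule: span_induct_alt)
  case base
  show ?case by (rule exI[of _ "\<lambda>i. 0"]) simp
next
  case (step a x y)
  then obtain j c where xy: "x = F j" "y = (\<Sum>i\<in>UNIV. c i *\<^sub>R F i)" by blast
  have "a *\<^sub>R x + y = (\<Sum>i\<in>UNIV. (c i + (if i = j then a else 0)) *\<^sub>R F i)"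
    by (simp add: xy scaleR_add_left sum.distrib if_distrib[of "\<lambda>r. r *\<^sub>R _"] cong: if_cong)
  then show ?case by (rule exI[of _ "\<lambda>i. c i + (if i = j then a else 0)"])
qed

lemma sum_fun_apply:
  fixes f :: "'i \<Rightarrow> 'b \<Rightarrow> 'c::comm_monoid_add"
  shows "(\<Sum>i\<in>I. f i) x = (\<Sum>i\<in>I. f i x)"
  by (induction I rule: infinite_finite_induct) simp_all

text \<open>A tangent vector \<open>v\<close> at \<open>p\<close> is carried by the left translation with the inverse of \<open>p\<close> to the
  derivation \<open>w\<close> at the identity. Expanding \<open>w\<close> in the frame there and translating back expresses
  \<open>v\<close> in the frame at \<open>p\<close> with the same coefficients.\<close>

lemma left_invariant_frame_spans:
  fixes E :: "'i::finite \<Rightarrow> 'a::{t2_space,second_countable_topology} vfield"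
  assumes LA: "lie_group L A" and E: "\<And>i. left_invariant L A (E i)"
    and span: "tangent_space A \<one>\<^bsub>L\<^esub> \<subseteq> span (range (\<lambda>i. E i \<one>\<^bsub>L\<^esub>))"
    and v: "v \<in> tangent_space A p"
  shows "\<exists>c. v = (\<Sum>i\<in>UNIV. c i *\<^sub>R E i p)"
proof -
  interpret group L using LA by (simp add: lie_group_def)
  have [simp]: "x \<in> carrier L" for x using LA by (simp add: lie_group_def)
  define w where "w f = v (\<lambda>r. f (inv\<^bsub>L\<^esub> p \<otimes>\<^bsub>L\<^esub> r))" for f
  have tr: "(\<lambda>r. f (q \<otimes>\<^bsub>L\<^esub> r)) \<in> smooth_funs A \<longleftrightarrow> f \<in> smooth_funs A" for f q
    using smooth_funs_left_translate[OF LA, of f q]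
      smooth_funs_left_translate[OF LA, of "\<lambda>r. f (q \<otimes>\<^bsub>L\<^esub> r)" "inv\<^bsub>L\<^esub> q"]
    by (auto simp: m_assoc[symmetric])
  have "w \<in> tangent_space A \<one>\<^bsub>L\<^esub>"
    using v unfolding tangent_space_iff w_def by (simp add: tr)
  then obtain c where c: "w = (\<Sum>i\<in>UNIV. c i *\<^sub>R E i \<one>\<^bsub>L\<^esub>)"
    using span span_range_imp_sum by blast
  have "v f = (\<Sum>i\<in>UNIV. c i *\<^sub>R E i p) f" for f
  proof (cases "f \<in> smooth_funs A")
    case True
    have E1: "E i (p \<otimes>\<^bsub>L\<^esub> \<one>\<^bsub>L\<^esub>) f = E i \<one>\<^bsub>L\<^esub> (\<lambda>r. f (p \<otimes>\<^bsub>L\<^esub> r))" for i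
      using E[of i] True unfolding left_invariant_def by blast
    have "v f = w (\<lambda>r. f (p \<otimes>\<^bsub>L\<^esub> r))" by (simp add: w_def m_assoc[symmetric])
    also have "\<dots> = (\<Sum>i\<in>UNIV. c i * E i \<one>\<^bsub>L\<^esub> (\<lambda>r. f (p \<otimes>\<^bsub>L\<^esub> r)))"
      by (simp add: c sum_fun_apply scaleR_fun_def)
    also have "\<dots> = (\<Sum>i\<in>UNIV. c i * E i (p \<otimes>\<^bsub>L\<^esub> \<one>\<^bsub>L\<^esub>) f)"
      by (simp only: E1)
    finally show ?thesis by (simp add: sum_fun_apply scaleR_fun_def)
  next
    case False
    have "E i p \<in> tangent_space A p" for i
      using E vfields_tangent unfolding left_invariant_def by blast
    then show ?thesis using v False by (simp add: tangent_space_iff sum_fun_apply scaleR_fun_def)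
  qed
  then show ?thesis by blast
qed

section \<open>Linear algebra of a neutral metric with an almost complex structure\<close>

text \<open>Ring normalization confined to the reals: it must not reorder the vector sums to which a linear
  map is applied, or the linearity rules no longer match.\<close>

lemmas real_algebra = distrib_left[where 'a=real] distrib_right[where 'a=real]
  left_diff_distrib[where 'a=real] right_diff_distrib[where 'a=real] diff_divide_distrib[where 'a=real]
  add_divide_distrib[where 'a=real]
  mult.commute[where 'a=real] mult.left_commute[where 'a=real] mult.assoc[where 'a=real]
  add.commute[where 'a=real] add.left_commute[where 'a=real] add.assoc[where 'a=real]

lemma linear_overD:
  assumes "linear_over V f" "x \<in> V" "y \<in> V"
  shows "f (c *\<^sub>R x + y) = c *\<^sub>R f x + f y"
  using assms by (simp add: linear_over_def)

lemma linear_over_zero: "linear_over V f \<Longrightarrow> subspace V \<Longrightarrow> f 0 = 0"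
  using linear_overD[of V f 0 0 1] by (simp add: subspace_0)

lemma linear_over_scale: "linear_over V f \<Longrightarrow> subspace V \<Longrightarrow> x \<in> V \<Longrightarrow> f (c *\<^sub>R x) = c *\<^sub>R f x"
  using linear_overD[of V f x 0 c] linear_over_zero[of V f] by (simp add: subspace_0)

lemma linear_over_minus: "linear_over V f \<Longrightarrow> subspace V \<Longrightarrow> x \<in> V \<Longrightarrow> f (- x) = - f x"
  using linear_over_scale[of V f x "-1"] by simp

lemma linear_over_sum:
  assumes "linear_over V f" "subspace V" "\<And>i. e i \<in> V"
  shows "finite I \<Longrightarrow> f (\<Sum>i\<in>I. c i *\<^sub>R e i) = (\<Sum>i\<in>I. c i *\<^sub>R f (e i))"
proof (induction I rule: finite_induct)
  case empty
  then show ?case using linear_over_zero[OF assms(1,2)] by simp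
next
  case (insert i I)
  have "(\<Sum>i\<in>I. c i *\<^sub>R e i) \<in> V"
    by (intro subspace_sum[OF assms(2)] subspace_scale[OF assms(2) assms(3)])
  then show ?case
    using linear_overD[OF assms(1,3), of "\<Sum>i\<in>I. c i *\<^sub>R e i" "c i" i] insert by simp
qed

lemma fundamental_tensors_diff:
  assumes "F \<in> fundamental_tensors \<epsilon> V J" "G \<in> fundamental_tensors \<epsilon> V J"
  shows "F - G \<in> fundamental_tensors \<epsilon> V J"
proof -
  have diff: "linear_over V (\<lambda>u. f u - h u)" if "linear_over V f" "linear_over V h" for f h :: "'a \<Rightarrow> real"
    using that unfolding linear_over_def by (simp add: real_algebra)
  then have "trilinear_over V (F - G)"
    using assms unfolding fundamental_tensors_def trilinear_over_def fun_diff_def by blast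
  moreover have "(F - G) x y z = - \<epsilon> * (F - G) x z y \<and> (F - G) x y z = - \<epsilon> * (F - G) x (J y) (J z)"
    if "x \<in> V" "y \<in> V" "z \<in> V" for x y z
  proof -
    have "F x y z = - \<epsilon> * F x z y \<and> F x y z = - \<epsilon> * F x (J y) (J z)"
      "G x y z = - \<epsilon> * G x z y \<and> G x y z = - \<epsilon> * G x (J y) (J z)"
      using assms that unfolding fundamental_tensors_def by blast+
    then show ?thesis by (simp add: right_diff_distrib)
  qed
  ultimately show ?thesis unfolding fundamental_tensors_def by blast
qed

definition neutral_sign :: "4 \<Rightarrow> real"
  where "neutral_sign i = (if i = 1 \<or> i = 2 then 1 else -1)"

lemma neutral_sign_sq [simp]: "neutral_sign i * neutral_sign i = 1"
  "neutral_sign i * (neutral_sign i * c) = c"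
  by (simp_all add: neutral_sign_def)

lemma neutral_sign_simps [simp]:
  "neutral_sign 1 = 1" "neutral_sign 2 = 1" "neutral_sign 3 = -1" "neutral_sign 4 = -1"
  by (simp_all add: neutral_sign_def)

text \<open>The tangent space at one point, with the metric and the left-invariant frame there. Like the tangent
  space it is a subspace of a larger type, so all linearity is relative to \<open>V\<close>.\<close>

locale neutral_space =
  fixes V :: "'v::real_vector set" and g :: "'v \<Rightarrow> 'v \<Rightarrow> real" and e :: "4 \<Rightarrow> 'v"
  assumes subspace: "subspace V"
    and frame_in [simp]: "e i \<in> V"
    and frame_spans: "x \<in> V \<Longrightarrow> \<exists>c. x = (\<Sum>i\<in>UNIV. c i *\<^sub>R e i)"
    and metric_linear: "x \<in> V \<Longrightarrow> linear_over V (g x)"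
    and metric_sym: "x \<in> V \<Longrightarrow> y \<in> V \<Longrightarrow> g x y = g y x"
    and gram: "g (e i) (e j) = (if i = j then neutral_sign i else 0)"
begin

lemma V_closed [simp]:
  "0 \<in> V" "x \<in> V \<Longrightarrow> y \<in> V \<Longrightarrow> x + y \<in> V" "x \<in> V \<Longrightarrow> c *\<^sub>R x \<in> V" "x \<in> V \<Longrightarrow> - x \<in> V"
  using subspace by (auto simp: subspace_0 subspace_add subspace_scale subspace_neg)

lemma metric_lin:
  assumes "x \<in> V" "z \<in> V"
  shows "y \<in> V \<Longrightarrow> g z (c *\<^sub>R x + y) = c * g z x + g z y"
    "y \<in> V \<Longrightarrow> g (c *\<^sub>R x + y) z = c * g x z + g y z"
    "g z (- x) = - g z x" "g (- x) z = - g x z"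
proof -
  show *: "y \<in> V \<Longrightarrow> g z (c *\<^sub>R x + y) = c * g z x + g z y" "g z (- x) = - g z x"
    using linear_overD[OF metric_linear] linear_over_minus[OF metric_linear _ ] subspace assms by auto
  show "y \<in> V \<Longrightarrow> g (c *\<^sub>R x + y) z = c * g x z + g y z" "g (- x) z = - g x z"
    using * metric_sym[of z] assms by simp_all
qed

lemma metric_comb:
  assumes "x \<in> V" "y \<in> V" "z \<in> V"
  shows "g (c *\<^sub>R x - d *\<^sub>R y) z = c * g x z - d * g y z"
proof -
  have "g ((- d) *\<^sub>R y + 0) z = (- d) * g y z + g 0 z" "g 0 z = 0"
    using assms metric_lin(2)[of y z 0 "- d"] metric_lin(2)[of 0 z 0 1] by simp_all
  then show ?thesis using assms metric_lin(2)[of x z "(- d) *\<^sub>R y" c] by simp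
qed

lemma metric_diff: "x \<in> V \<Longrightarrow> y \<in> V \<Longrightarrow> z \<in> V \<Longrightarrow> g (x - y) z = g x z - g y z"
  using metric_comb[of x y z 1 1] by simp

definition coord :: "4 \<Rightarrow> 'v \<Rightarrow> real"
  where "coord i x = neutral_sign i * g x (e i)"

lemma frame_expansion:
  assumes "x \<in> V"
  shows "x = (\<Sum>i\<in>UNIV. coord i x *\<^sub>R e i)"
proof -
  obtain c where c: "x = (\<Sum>i\<in>UNIV. c i *\<^sub>R e i)" using frame_spans[OF assms] by blast
  have "g (e i) x = c i * neutral_sign i" for i
    unfolding c using linear_over_sum[OF metric_linear[of "e i"] subspace, of e UNIV c]
    by (simp add: gram if_distrib[of "\<lambda>r. _ * r"] cong: if_cong)
  then have "coord i x = c i" for i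
    using metric_sym[OF assms frame_in] by (simp add: coord_def)
  then show ?thesis using c by simp
qed

lemma linear_over_expand:
  assumes "linear_over V f" "x \<in> V"
  shows "f x = (\<Sum>i\<in>UNIV. coord i x *\<^sub>R f (e i))"
  using linear_over_sum[OF assms(1) subspace, of e UNIV "\<lambda>i. coord i x"]
    frame_expansion[OF assms(2)] by simp

lemma coord_frame [simp]: "coord i (e j) = (if i = j then 1 else 0)"
  by (auto simp: coord_def gram)

lemma coord_lin:
  assumes "x \<in> V"
  shows "y \<in> V \<Longrightarrow> coord i (c *\<^sub>R x + y) = c * coord i x + coord i y" "coord i (- x) = - coord i x"
  using assms by (simp_all add: coord_def metric_lin real_algebra)

lemma metric_coord:
  assumes "x \<in> V" "y \<in> V"
  shows "g x y = coord 1 x * coord 1 y + coord 2 x * coord 2 y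
    - coord 3 x * coord 3 y - coord 4 x * coord 4 y"
proof -
  have "g x y = (\<Sum>i\<in>UNIV. coord i y * g x (e i))"
    using linear_over_expand[OF metric_linear[OF assms(1)] assms(2)] by simp
  then show ?thesis by (simp add: sum_4 coord_def)
qed

text \<open>The Gram matrix is its own inverse, because the frame is orthonormal up to signs.\<close>

lemma lee_form_frame:
  "lee_form g e F z = (\<Sum>k\<in>UNIV. neutral_sign k * F (e k) (e k) z)"
proof -
  let ?G = "\<chi> i j. g (e i) (e j)"
  have "?G ** ?G = mat 1"
    by (auto simp: vec_eq_iff matrix_matrix_mult_def mat_def gram if_distrib[of "\<lambda>r. r * _"]
        if_distrib[of "\<lambda>r. _ * r"] cong: if_cong)
  moreover from this have "B = ?G" if "?G ** B = mat 1" for B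
    using that matrix_mul_assoc[of ?G ?G B] by simp
  ultimately have "matrix_inv ?G = ?G" unfolding matrix_inv_def by (intro some_equality) auto
  then show ?thesis
    by (simp add: lee_form_def gram if_distrib[of "\<lambda>r. r * _"] cong: if_cong)
qed

text \<open>Contracting with the metric evaluates a linear form: \<open>g\<^sup>k\<^sup>l g(e\<^sub>k, x) f(e\<^sub>l) = f(x)\<close>.\<close>

lemma contraction:
  assumes "linear_over V f" "x \<in> V"
  shows "(\<Sum>k\<in>UNIV. neutral_sign k * (g (e k) x * f (e k))) = f x"
  using linear_over_expand[OF assms] metric_sym[OF _ assms(2)] by (simp add: coord_def mult.assoc)

lemma linear_over_eqI:
  assumes "linear_over V f" "linear_over V h" "\<And>i. f (e i) = h (e i)" "x \<in> V"
  shows "f x = h x"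
  using linear_over_expand[OF assms(1,4)] linear_over_expand[OF assms(2,4)] assms(3) by simp

lemma metric_linear_left: "z \<in> V \<Longrightarrow> linear_over V (\<lambda>u. g u z)"
  by (simp add: linear_over_def metric_lin)

lemma trilinear_eq_zeroI:
  assumes "trilinear_over V K" "\<And>i j k. K (e i) (e j) (e k) = 0" "x \<in> V" "y \<in> V" "z \<in> V"
  shows "K x y z = 0"
proof -
  have 0: "f u = 0" if "linear_over V f" "\<And>i. f (e i) = 0" "u \<in> V" for f :: "'v \<Rightarrow> real" and u
    using linear_over_expand[OF that(1,3)] that(2) by simp
  have "K (e i) (e j) z = 0" for i j
    using 0[of "K (e i) (e j)"] assms by (simp add: trilinear_over_def)
  then have "K (e i) y z = 0" for i
    using 0[of "\<lambda>u. K (e i) u z"] assms by (simp add: trilinear_over_def)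
  then show ?thesis
    using 0[of "\<lambda>u. K u y z"] assms by (simp add: trilinear_over_def)
qed

end

text \<open>The sign \<open>\<epsilon>\<close> is 1 for a Hermitian metric and -1 for a Norden metric.\<close>

locale almost_complex_space = neutral_space V g e for V :: "'v::real_vector set" and g e +
  fixes J :: "'v \<Rightarrow> 'v" and \<epsilon> :: real
  assumes J_linear: "linear_over V J"
    and J_in [simp]: "x \<in> V \<Longrightarrow> J x \<in> V"
    and J_J [simp]: "x \<in> V \<Longrightarrow> J (J x) = - x"
    and \<epsilon>_sq: "\<epsilon> * \<epsilon> = 1"
    and J_metric: "x \<in> V \<Longrightarrow> y \<in> V \<Longrightarrow> g (J x) (J y) = \<epsilon> * g x y"
begin

lemma J_lin:
  assumes "x \<in> V"
  shows "y \<in> V \<Longrightarrow> J (c *\<^sub>R x + y) = c *\<^sub>R J x + J y" "J (- x) = - J x"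
  using linear_overD[OF J_linear] linear_over_minus[OF J_linear subspace] assms by auto

lemma J_adjoint: "x \<in> V \<Longrightarrow> y \<in> V \<Longrightarrow> g (J x) y = - \<epsilon> * g x (J y)"
  using J_metric[of x "J y"] by (simp add: metric_lin)

lemma tensorD:
  assumes F: "F \<in> fundamental_tensors \<epsilon> V J" and "x \<in> V" "y \<in> V" "z \<in> V"
  shows "w \<in> V \<Longrightarrow> F (c *\<^sub>R x + w) y z = c * F x y z + F w y z"
    "w \<in> V \<Longrightarrow> F x (c *\<^sub>R y + w) z = c * F x y z + F x w z"
    "w \<in> V \<Longrightarrow> F x y (c *\<^sub>R z + w) = c * F x y z + F x y w"
    "F (- x) y z = - F x y z" "F x (- y) z = - F x y z" "F x y (- z) = - F x y z"
    "F x z y = - \<epsilon> * F x y z" "F x (J y) (J z) = - \<epsilon> * F x y z"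
    "F x (J y) z = \<epsilon> * F x y (J z)"
proof -
  have lin: "linear_over V (\<lambda>u. F u y z)" "linear_over V (\<lambda>u. F x u z)" "linear_over V (\<lambda>u. F x y u)"
    using assms by (auto simp: fundamental_tensors_def trilinear_over_def)
  show "w \<in> V \<Longrightarrow> F (c *\<^sub>R x + w) y z = c * F x y z + F w y z"
    "w \<in> V \<Longrightarrow> F x (c *\<^sub>R y + w) z = c * F x y z + F x w z"
    "w \<in> V \<Longrightarrow> F x y (c *\<^sub>R z + w) = c * F x y z + F x y w"
    using lin assms(2-4) by (simp_all add: linear_over_def)
  show neg: "F (- x) y z = - F x y z" "F x (- y) z = - F x y z" "F x y (- z) = - F x y z"
    using linear_over_minus[OF lin(1) subspace assms(2)] linear_over_minus[OF lin(2) subspace assms(3)]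
      linear_over_minus[OF lin(3) subspace assms(4)] by simp_all
  have sym: "F x y z = - \<epsilon> * F x z y" and J: "F x y z = - \<epsilon> * F x (J y) (J z)"
    if "x \<in> V" "y \<in> V" "z \<in> V" for x y z
    using F that unfolding fundamental_tensors_def by blast+
  show "F x z y = - \<epsilon> * F x y z" using sym[of x z y] assms by simp
  have "\<epsilon> * F x y z = - (\<epsilon> * \<epsilon>) * F x (J y) (J z)"
    using J[OF assms(2-4)] by simp
  then show "F x (J y) (J z) = - \<epsilon> * F x y z" by (simp add: \<epsilon>_sq)
  have "linear_over V (\<lambda>u. F x u (J z))"
    using assms by (auto simp: fundamental_tensors_def trilinear_over_def)
  then have "F x (- y) (J z) = - F x y (J z)"
    using linear_over_minus[OF _ subspace assms(3)] by blast
  then show "F x (J y) z = \<epsilon> * F x y (J z)"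
    using J[of x "J y" z] assms by simp
qed

lemma lee_form_linear:
  assumes F: "F \<in> fundamental_tensors \<epsilon> V J"
  shows "linear_over V (lee_form g e F)"
  unfolding linear_over_def
  by (simp add: lee_form_frame tensorD(3)[OF F] sum.distrib sum_distrib_left real_algebra)

lemma lee_lin:
  assumes F: "F \<in> fundamental_tensors \<epsilon> V J" and "x \<in> V"
  shows "y \<in> V \<Longrightarrow> lee_form g e F (c *\<^sub>R x + y) = c * lee_form g e F x + lee_form g e F y"
    "lee_form g e F (- x) = - lee_form g e F x"
  using linear_overD[OF lee_form_linear[OF F]] linear_over_minus[OF lee_form_linear[OF F] subspace]
    assms(2) by auto

lemma lee_form_diff: "lee_form g e (F - G) z = lee_form g e F z - lee_form g e G z"
  by (simp add: lee_form_frame sum_subtractf real_algebra)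

text \<open>The traces that occur in the Lee form of a Lee part, for either kind of metric.\<close>

lemma lee_contractions:
  assumes F: "F \<in> fundamental_tensors \<epsilon> V J" and "z \<in> V"
  shows "(\<Sum>k\<in>UNIV. neutral_sign k * (g (e k) (e k) * c)) = 4 * c"
    "(\<Sum>k\<in>UNIV. neutral_sign k * (g (e k) z * lee_form g e F (e k))) = lee_form g e F z"
    "(\<Sum>k\<in>UNIV. neutral_sign k * (g (e k) (J z) * lee_form g e F (J (e k)))) = - lee_form g e F z"
proof -
  show "(\<Sum>k\<in>UNIV. neutral_sign k * (g (e k) (e k) * c)) = 4 * c"
    by (simp add: gram)
  show "(\<Sum>k\<in>UNIV. neutral_sign k * (g (e k) z * lee_form g e F (e k))) = lee_form g e F z"
    by (rule contraction[OF lee_form_linear[OF F] assms(2)])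
  have "linear_over V (\<lambda>u. lee_form g e F (J u))"
    unfolding linear_over_def by (simp add: J_lin lee_lin[OF F])
  from contraction[OF this, of "J z"]
  show "(\<Sum>k\<in>UNIV. neutral_sign k * (g (e k) (J z) * lee_form g e F (J (e k)))) = - lee_form g e F z"
    using assms(2) by (simp add: lee_lin[OF F])
qed

end

section \<open>Norden metrics: splitting off the Lee part and the Nijenhuis part\<close>

text \<open>The trace of \<open>J\<close> enters the Lee form of a Lee part. For a Norden metric the terms \<open>g(e\<^sub>k, J e\<^sub>k)\<close>
  need not vanish one by one, as they do for a Hermitian metric.\<close>

locale norden_space = almost_complex_space V g e J "-1"
  for V :: "'v::real_vector set" and g e J +
  assumes J_trace: "(\<Sum>k\<in>UNIV. neutral_sign k * g (e k) (J (e k))) = 0"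
begin

definition lee_part :: "'v tensor3 \<Rightarrow> 'v tensor3"
  where "lee_part F x y z = 1/4 *
      (g x y * lee_form g e F z + g x (J y) * lee_form g e F (J z)
       + g x z * lee_form g e F y + g x (J z) * lee_form g e F (J y))"

text \<open>A 3-form. In the Ganchev-Borisov classification its vanishing characterizes
  \<open>W\<^sub>1 \<oplus> W\<^sub>2\<close>, the class of vanishing Nijenhuis tensor.\<close>

definition nijenhuis_form :: "'v tensor3 \<Rightarrow> 'v tensor3"
  where "nijenhuis_form F = cyclic_sum (\<lambda>x y z. F x y (J z))"

text \<open>The \<open>W\<^sub>3\<close> component of \<open>F\<close>. It is the combination of the Nijenhuis form that has the symmetries of a
  fundamental tensor; the factor makes it reproduce that form.\<close>

definition nijenhuis_part :: "'v tensor3 \<Rightarrow> 'v tensor3"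
  where "nijenhuis_part F x y z = 1/4 * (nijenhuis_form F x (J y) z - nijenhuis_form F x y (J z))"

lemma nijenhuis_form_diff: "nijenhuis_form (F - G) x y z = nijenhuis_form F x y z - nijenhuis_form G x y z"
  by (simp add: nijenhuis_form_def cyclic_sum_def)

context
  fixes F assumes F: "F \<in> fundamental_tensors (-1) V J"
begin

lemma lee_part_fundamental: "lee_part F \<in> fundamental_tensors (-1) V J"
  unfolding fundamental_tensors_def trilinear_over_def linear_over_def
  by (auto simp: lee_part_def metric_lin J_lin lee_lin[OF F] real_algebra)

lemma lee_form_lee_part:
  assumes "z \<in> V"
  shows "lee_form g e (lee_part F) z = lee_form g e F z"
proof -
  let ?\<theta> = "lee_form g e F"
  have "lee_form g e (lee_part F) z = 1/4 * (
      (\<Sum>k\<in>UNIV. neutral_sign k * (g (e k) (e k) * ?\<theta> z))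
      + (\<Sum>k\<in>UNIV. neutral_sign k * g (e k) (J (e k))) * ?\<theta> (J z)
      + (\<Sum>k\<in>UNIV. neutral_sign k * (g (e k) z * ?\<theta> (e k)))
      + (\<Sum>k\<in>UNIV. neutral_sign k * (g (e k) (J z) * ?\<theta> (J (e k)))))"
    unfolding lee_form_frame[of "lee_part F"] lee_part_def sum_distrib_left sum_distrib_right
      sum.distrib[symmetric]
    by (intro sum.cong) (simp_all add: real_algebra)
  then show ?thesis by (simp only: lee_contractions[OF F assms] J_trace) simp
qed

text \<open>In the Norden case both \<open>g\<close> and \<open>g(\<cdot>, J \<cdot>)\<close> are symmetric, and the terms of the cyclic sum
  cancel in pairs.\<close>

lemma nijenhuis_form_lee_part:
  assumes "x \<in> V" "y \<in> V" "z \<in> V"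
  shows "nijenhuis_form (lee_part F) x y z = 0"
proof -
  have "g y x = g x y" "g z x = g x z" "g z y = g y z"
    "g y (J x) = g x (J y)" "g z (J x) = g x (J z)" "g z (J y) = g y (J z)"
    using assms metric_sym J_adjoint by (metis J_in minus_minus mult_1 mult_minus_left)+
  then show ?thesis using assms
    by (simp add: nijenhuis_form_def cyclic_sum_def lee_part_def metric_lin lee_lin[OF F] real_algebra)
qed

lemma nijenhuis_form_lin:
  assumes "x \<in> V" "y \<in> V" "z \<in> V"
  shows "w \<in> V \<Longrightarrow> nijenhuis_form F (c *\<^sub>R x + w) y z = c * nijenhuis_form F x y z + nijenhuis_form F w y z"
    "w \<in> V \<Longrightarrow> nijenhuis_form F x (c *\<^sub>R y + w) z = c * nijenhuis_form F x y z + nijenhuis_form F x w z"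
    "w \<in> V \<Longrightarrow> nijenhuis_form F x y (c *\<^sub>R z + w) = c * nijenhuis_form F x y z + nijenhuis_form F x y w"
    "nijenhuis_form F (- x) y z = - nijenhuis_form F x y z"
    "nijenhuis_form F x (- y) z = - nijenhuis_form F x y z"
    "nijenhuis_form F x y (- z) = - nijenhuis_form F x y z"
  using assms by (simp_all add: nijenhuis_form_def cyclic_sum_def J_lin tensorD(1-6)[OF F] real_algebra)

lemma nijenhuis_form_alternating:
  assumes "x \<in> V" "y \<in> V" "z \<in> V"
  shows "nijenhuis_form F x z y = - nijenhuis_form F x y z"
    "nijenhuis_form F y x z = - nijenhuis_form F x y z"
    "nijenhuis_form F y z x = nijenhuis_form F x y z"
    "nijenhuis_form F z x y = nijenhuis_form F x y z"
proof -
  have "F u v (J w) = - F u w (J v)" if "u \<in> V" "v \<in> V" "w \<in> V" for u v w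
    using tensorD(9)[OF F that] tensorD(7)[OF F that(1,3), of "J v"] that by simp
  from this[of x y z] this[of y x z] this[of z x y]
  show "nijenhuis_form F x z y = - nijenhuis_form F x y z"
    "nijenhuis_form F y x z = - nijenhuis_form F x y z"
    using assms by (simp_all add: nijenhuis_form_def cyclic_sum_def)
  show "nijenhuis_form F y z x = nijenhuis_form F x y z"
    "nijenhuis_form F z x y = nijenhuis_form F x y z"
    by (simp_all add: nijenhuis_form_def cyclic_sum_def)
qed

lemma nijenhuis_part_fundamental: "nijenhuis_part F \<in> fundamental_tensors (-1) V J"
  unfolding fundamental_tensors_def trilinear_over_def linear_over_def
proof (clarify, intro conjI ballI allI)
  fix x y z w assume *: "x \<in> V" "y \<in> V" "z \<in> V"
  show "nijenhuis_part F x y z = - (-1) * nijenhuis_part F x z y"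
    using * nijenhuis_form_alternating(1)[of x "J y" z] nijenhuis_form_alternating(1)[of x y "J z"]
    by (simp add: nijenhuis_part_def)
  show "nijenhuis_part F x y z = - (-1) * nijenhuis_part F x (J y) (J z)"
    using * by (simp add: nijenhuis_part_def nijenhuis_form_lin(4-6))
qed (simp_all add: nijenhuis_part_def J_lin nijenhuis_form_lin real_algebra)

text \<open>By the cyclic invariance of the Nijenhuis form the six terms cancel in pairs.\<close>

lemma cyclic_sum_nijenhuis_part:
  assumes "x \<in> V" "y \<in> V" "z \<in> V"
  shows "cyclic_sum (nijenhuis_part F) x y z = 0"
  using assms nijenhuis_form_alternating(3)[of x y "J z"] nijenhuis_form_alternating(3)[of "J x" y z]
    nijenhuis_form_alternating(3)[of x "J y" z] nijenhuis_form_alternating(4)[of x y "J z"]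
    nijenhuis_form_alternating(4)[of "J x" y z] nijenhuis_form_alternating(4)[of x "J y" z]
  by (simp add: cyclic_sum_def nijenhuis_part_def diff_divide_distrib)

lemma nijenhuis_part_in_W3: "nijenhuis_part F \<in> norden_W3 V J"
  using nijenhuis_part_fundamental cyclic_sum_nijenhuis_part by (simp add: norden_W3_def)

lemma lee_part_in_W1: "lee_part F \<in> norden_W1 V g e J"
  using lee_part_fundamental by (simp add: norden_W1_def lee_form_lee_part lee_part_def)

text \<open>The cyclic sum of \<open>\<omega>(x, J y, J z)\<close> is again \<open>\<omega>(x, y, z)\<close>, since \<open>\<omega>\<close> comes from a
  fundamental tensor. Together with the three copies of \<open>\<omega>\<close> from its cyclic invariance, this
  yields four copies, which explains the factor 1/4.\<close>

lemma nijenhuis_form_nijenhuis_part: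
  assumes "x \<in> V" "y \<in> V" "z \<in> V"
  shows "nijenhuis_form (nijenhuis_part F) x y z = nijenhuis_form F x y z"
proof -
  have t: "nijenhuis_part F u v (J w) = 1/4 * (nijenhuis_form F u (J v) (J w) + nijenhuis_form F u v w)"
    if "u \<in> V" "v \<in> V" "w \<in> V" for u v w
    using that by (simp add: nijenhuis_part_def nijenhuis_form_lin(6))
  have o: "nijenhuis_form F u (J v) (J w) = F u v (J w) + F (J v) u w - F (J w) u v"
    if "u \<in> V" "v \<in> V" "w \<in> V" for u v w
    using that tensorD(9)[OF F, of u v "- w"] tensorD(8)[OF F, of "J v" w u]
      tensorD(7)[OF F, of "J v" u w]
    by (simp add: nijenhuis_form_def cyclic_sum_def tensorD(6)[OF F] J_lin(2))
  have "F (J u) w v = F (J u) v w" if "u \<in> V" "v \<in> V" "w \<in> V" for u v w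
    using tensorD(7)[OF F, of "J u"] that by simp
  from this[of x y z] this[of y x z] this[of z x y]
  have "nijenhuis_form F x (J y) (J z) + nijenhuis_form F y (J z) (J x) + nijenhuis_form F z (J x) (J y)
      = nijenhuis_form F x y z"
    using assms by (simp add: o) (simp add: nijenhuis_form_def cyclic_sum_def)
  moreover have "nijenhuis_form (nijenhuis_part F) x y z
      = (nijenhuis_form F x (J y) (J z) + nijenhuis_form F x y z) / 4
      + (nijenhuis_form F y (J z) (J x) + nijenhuis_form F x y z) / 4
      + (nijenhuis_form F z (J x) (J y) + nijenhuis_form F x y z) / 4"
    unfolding nijenhuis_form_def[of "nijenhuis_part F"] cyclic_sum_def
    using assms nijenhuis_form_alternating(3,4)[of x y z] by (simp add: t)
  ultimately show ?thesis by argo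
qed

text \<open>The trace pairs the tensor \<open>g(J x, y)\<close>, symmetric for a Norden metric, with a 3-form.\<close>

lemma lee_form_nijenhuis_part:
  assumes z: "z \<in> V"
  shows "lee_form g e (nijenhuis_part F) z = 0"
proof -
  let ?\<omega> = "\<lambda>x y. nijenhuis_form F x y z" and ?s = neutral_sign
  have lin: "linear_over V (\<lambda>v. ?\<omega> u v)" if "u \<in> V" for u
    using that z by (simp add: linear_over_def nijenhuis_form_lin)
  have skew: "?\<omega> v u = - ?\<omega> u v" if "u \<in> V" "v \<in> V" for u v
    using that z nijenhuis_form_alternating by blast
  have gJ: "g (J (e k)) (e l) = g (J (e l)) (e k)" for k l
    using J_adjoint[of "e k" "e l"] metric_sym[of "e k" "J (e l)"] by simp
  have ex: "?\<omega> (e k) (J (e k)) = (\<Sum>l\<in>UNIV. ?s l * g (J (e k)) (e l) * ?\<omega> (e k) (e l))" for k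
    using linear_over_expand[OF lin, of "e k" "J (e k)"] by (simp add: coord_def)
  define S where "S = (\<Sum>k\<in>UNIV. \<Sum>l\<in>UNIV. ?s k * ?s l * g (J (e k)) (e l) * ?\<omega> (e k) (e l))"
  have "S = (\<Sum>l\<in>UNIV. \<Sum>k\<in>UNIV. ?s k * ?s l * g (J (e k)) (e l) * ?\<omega> (e k) (e l))"
    unfolding S_def by (rule sum.swap)
  also have "\<dots> = - S"
  proof -
    have "?s k * ?s l * g (J (e k)) (e l) * ?\<omega> (e k) (e l)
        = - (?s l * ?s k * g (J (e l)) (e k) * ?\<omega> (e l) (e k))" for k l
      using gJ[of k l] skew[of "e k" "e l"] by simp
    then show ?thesis
      unfolding S_def sum_negf[symmetric] by (intro sum.cong refl)
  qed
  finally have "S = 0" by simp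
  moreover have "S = (\<Sum>k\<in>UNIV. ?s k * ?\<omega> (e k) (J (e k)))"
    unfolding S_def ex by (simp add: sum_distrib_left mult.assoc)
  moreover have "nijenhuis_form F (e k) (e k) (J z) = 0" for k
    using nijenhuis_form_alternating(2)[of "e k" "e k" "J z"] z by simp
  ultimately show ?thesis
    unfolding lee_form_frame nijenhuis_part_def by (simp add: sum_divide_distrib[symmetric])
qed

end

lemma norden_W2I:
  assumes "F \<in> fundamental_tensors (-1) V J"
    and "\<And>z. z \<in> V \<Longrightarrow> lee_form g e F z = 0"
    and "\<And>x y z. x \<in> V \<Longrightarrow> y \<in> V \<Longrightarrow> z \<in> V \<Longrightarrow> nijenhuis_form F x y z = 0"
  shows "F \<in> norden_W2 V g e J"
  using assms unfolding norden_W2_def nijenhuis_form_def by simp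

text \<open>The three components are split off separately: subtracting the Lee part kills the Lee form and leaves
  the Nijenhuis form alone, and subtracting the Nijenhuis part does the opposite. What has neither is
  in \<open>W\<^sub>2\<close>.\<close>

lemma norden_W1_W2:
  assumes F: "F \<in> fundamental_tensors (-1) V J"
    and "\<And>x y z. x \<in> V \<Longrightarrow> y \<in> V \<Longrightarrow> z \<in> V \<Longrightarrow> nijenhuis_form F x y z = 0"
  shows "F \<in> norden_W1 V g e J + norden_W2 V g e J"
proof -
  have "F - lee_part F \<in> norden_W2 V g e J"
    using assms(2) by (intro norden_W2I fundamental_tensors_diff F lee_part_fundamental)
      (simp_all add: lee_form_diff lee_form_lee_part[OF F] nijenhuis_form_diff nijenhuis_form_lee_part[OF F])
  from set_plus_intro[OF lee_part_in_W1[OF F] this] show ?thesis by simp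
qed

lemma norden_W2_W3:
  assumes F: "F \<in> fundamental_tensors (-1) V J"
    and "\<And>z. z \<in> V \<Longrightarrow> lee_form g e F z = 0"
  shows "F \<in> norden_W2 V g e J + norden_W3 V J"
proof -
  have "F - nijenhuis_part F \<in> norden_W2 V g e J"
    using assms(2) by (intro norden_W2I fundamental_tensors_diff F nijenhuis_part_fundamental)
      (simp_all add: lee_form_diff lee_form_nijenhuis_part[OF F] nijenhuis_form_diff
        nijenhuis_form_nijenhuis_part[OF F])
  from set_plus_intro[OF this nijenhuis_part_in_W3[OF F]] show ?thesis by simp
qed

lemma norden_W1_W2_W3:
  assumes F: "F \<in> fundamental_tensors (-1) V J"
  shows "F \<in> norden_W1 V g e J + norden_W2 V g e J + norden_W3 V J"
proof -
  have "F - lee_part F \<in> norden_W2 V g e J + norden_W3 V J"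
    by (intro norden_W2_W3 fundamental_tensors_diff F lee_part_fundamental)
      (simp_all add: lee_form_diff lee_form_lee_part[OF F])
  from set_plus_intro[OF lee_part_in_W1[OF F] this] show ?thesis by (simp add: add.assoc)
qed

end

section \<open>Hermitian metrics in dimension 4\<close>

text \<open>The frame is adapted to \<open>J\<close>: it consists of bases of two orthogonal \<open>J\<close>-invariant planes.\<close>

locale hermitian_space = almost_complex_space V g e J 1
  for V :: "'v::real_vector set" and g e J +
  assumes J_frame: "J (e 1) = e 2" "J (e 3) = - e 4"
begin

lemma J_frame': "J (e 2) = - e 1" "J (e 4) = e 3"
  using J_J[of "e 1"] J_J[of "e 3"] by (simp_all add: J_frame J_lin(2) minus_equation_iff)

definition lee_part :: "'v tensor3 \<Rightarrow> 'v tensor3"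
  where "lee_part F x y z = 1/2 *
      (g x y * lee_form g e F z - g x (J y) * lee_form g e F (J z)
       - g x z * lee_form g e F y + g x (J z) * lee_form g e F (J y))"

context
  fixes F assumes F: "F \<in> fundamental_tensors 1 V J"
begin

lemma lee_part_fundamental: "lee_part F \<in> fundamental_tensors 1 V J"
  unfolding fundamental_tensors_def trilinear_over_def linear_over_def
  by (auto simp: lee_part_def metric_lin J_lin lee_lin[OF F] real_algebra)

lemma lee_form_lee_part:
  assumes "z \<in> V"
  shows "lee_form g e (lee_part F) z = lee_form g e F z"
proof -
  let ?\<theta> = "lee_form g e F"
  have "g (e k) (J (e k)) = 0" for k
    using J_adjoint[of "e k" "e k"] metric_sym[of "e k" "J (e k)"] by simp
  then have "lee_form g e (lee_part F) z = 1/2 * (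
      (\<Sum>k\<in>UNIV. neutral_sign k * (g (e k) (e k) * ?\<theta> z))
      - (\<Sum>k\<in>UNIV. neutral_sign k * (g (e k) z * ?\<theta> (e k)))
      + (\<Sum>k\<in>UNIV. neutral_sign k * (g (e k) (J z) * ?\<theta> (J (e k)))))"
    unfolding lee_form_frame[of "lee_part F"] lee_part_def sum_distrib_left sum_distrib_right
      sum.distrib[symmetric] sum_subtractf[symmetric]
    by (intro sum.cong) (simp_all add: real_algebra)
  then show ?thesis by (simp only: lee_contractions[OF F assms]) simp
qed

lemma lee_part_in_W4: "lee_part F \<in> hermitian_W4 V g e J"
  using lee_part_fundamental by (simp add: hermitian_W4_def lee_form_lee_part lee_part_def)

text \<open>On a \<open>J\<close>-invariant plane the cyclic sum reduces to the trace of \<open>F\<close> over that plane.\<close>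

lemma cyclic_sum_J_line:
  assumes "x \<in> V" "z \<in> V"
  shows "cyclic_sum F x (J x) z = F x x (J z) + F (J x) (J x) (J z)"
proof -
  have "F z x (J x) = 0"
    using tensorD(9)[OF F assms(2,1,1)] tensorD(7)[OF F assms(2,1) J_in[OF assms(1)]] by simp
  moreover have "F x (J x) z = F x x (J z)" using tensorD(9)[OF F assms(1,1,2)] by simp
  moreover have "F (J x) z x = F (J x) (J x) (J z)"
    using tensorD(8)[OF F, of "J x" x z] tensorD(7)[OF F, of "J x" x z] assms by simp
  ultimately show ?thesis by (simp add: cyclic_sum_def)
qed

text \<open>The cyclic sum is a 3-form, and in dimension 4 any three distinct frame vectors contain one of the
  pairs \<open>e\<^sub>1, e\<^sub>2\<close> and \<open>e\<^sub>3, e\<^sub>4\<close> that span a \<open>J\<close>-invariant plane. Hence its components are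
  partial traces of \<open>F\<close>, evaluated at a vector of the other plane. The trace over that other plane
  vanishes there, so the partial trace is the Lee form up to sign.\<close>

lemma lee_zero_imp_cyclic_sum_zero:
  assumes \<theta>: "\<And>z. z \<in> V \<Longrightarrow> lee_form g e F z = 0"
    and xyz: "x \<in> V" "y \<in> V" "z \<in> V"
  shows "cyclic_sum F x y z = 0"
proof -
  let ?K = "cyclic_sum F"
  have cyc: "?K v w u = ?K u v w" for u v w by (simp add: cyclic_sum_def)
  have skew: "?K v u w = - ?K u v w" if "u \<in> V" "v \<in> V" "w \<in> V" for u v w
    using that tensorD(7)[OF F, of u v w] tensorD(7)[OF F, of v u w] tensorD(7)[OF F, of w u v]
    by (simp add: cyclic_sum_def)
  have diag: "F u u u = 0" "F u u (J u) = 0" if "u \<in> V" for u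
    using tensorD(7)[OF F that that that] tensorD(7)[OF F that that J_in[OF that]]
      tensorD(9)[OF F that that that] by simp_all
  have K12: "?K (e 1) (e 2) (e k) = 0" for k
    using cyclic_sum_J_line[of "e 1" "e k"] \<theta>[of "J (e k)"] exhaust_4[of k]
      diag[of "e 1"] diag[of "e 2"] diag[of "e 3"] diag[of "e 4"]
    by (auto simp: lee_form_frame sum_4 J_frame J_frame' tensorD(6)[OF F])
  have K34: "?K (e 3) (e 4) (e k) = 0" for k
    using cyclic_sum_J_line[of "e 3" "e k"] \<theta>[of "J (e k)"] exhaust_4[of k]
      diag[of "e 1"] diag[of "e 2"] diag[of "e 3"] diag[of "e 4"]
    by (auto simp: lee_form_frame sum_4 J_frame J_frame' tensorD(4-6)[OF F] cyclic_sum_def)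
  show ?thesis
  proof (rule trilinear_eq_zeroI[OF _ _ xyz])
    show "trilinear_over V ?K"
      unfolding trilinear_over_def linear_over_def
      by (auto simp: cyclic_sum_def tensorD(1-3)[OF F] real_algebra)
    have rep: "?K (e m) (e m) (e l) = 0" "?K (e m) (e l) (e m) = 0" "?K (e l) (e m) (e m) = 0" for m l
      using skew[of "e m" "e m" "e l"] cyc[of "e m" "e l" "e m"] cyc[of "e l" "e m" "e m"] by simp_all
    have perm: "?K (e m) (e n) (e l) = 0" "?K (e n) (e l) (e m) = 0" "?K (e l) (e m) (e n) = 0"
      "?K (e n) (e m) (e l) = 0" "?K (e m) (e l) (e n) = 0" "?K (e l) (e n) (e m) = 0"
      if "?K (e m) (e n) (e l) = 0" for m n l
      using that skew[of "e m" "e n" "e l"] cyc[of "e m" "e n" "e l"] cyc[of "e n" "e l" "e m"]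
        cyc[of "e n" "e m" "e l"] cyc[of "e m" "e l" "e n"] by simp_all
    have "\<forall>i j k. ?K (e i) (e j) (e k) = 0"
      by (simp add: forall_4 rep perm[OF K12] perm[OF K34])
    then show "?K (e i) (e j) (e k) = 0" for i j k by blast
  qed
qed

lemma hermitian_W2I:
  assumes "\<And>z. z \<in> V \<Longrightarrow> lee_form g e F z = 0"
  shows "F \<in> hermitian_W2 V J"
  using F lee_zero_imp_cyclic_sum_zero[OF assms] by (simp add: hermitian_W2_def)

end

lemma hermitian_W2_W4:
  assumes F: "F \<in> fundamental_tensors 1 V J"
  shows "F \<in> hermitian_W2 V J + hermitian_W4 V g e J"
proof -
  have "F - lee_part F \<in> hermitian_W2 V J"
    by (intro hermitian_W2I fundamental_tensors_diff F lee_part_fundamental)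
      (simp_all add: lee_form_diff lee_form_lee_part[OF F])
  from set_plus_intro[OF this lee_part_in_W4[OF F]] show ?thesis by simp
qed

end

section \<open>The fundamental tensors of the Lie algebra\<close>

context neutral_space
begin

text \<open>This is \<open>g(S x, y)\<close> for the operator \<open>S x = [x, e\<^sub>4]\<close>, which is \<open>diag(1, a, b, 0)\<close> in the frame.\<close>

definition weight_form :: "real \<Rightarrow> real \<Rightarrow> 'v \<Rightarrow> 'v \<Rightarrow> real"
  where "weight_form a b x y = coord 1 x * coord 1 y + a * (coord 2 x * coord 2 y)
    - b * (coord 3 x * coord 3 y)"

text \<open>The value of \<open>g(\<nabla>\<^sub>x y, z)\<close> on left-invariant fields. The vectors \<open>e\<^sub>1, e\<^sub>2, e\<^sub>3\<close> commute and
  \<open>S\<close> is self-adjoint, so the formula of Koszul reduces to \<open>g(S x, y) g(z, e\<^sub>4) - g(S x, z) g(y, e\<^sub>4)\<close>;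
  the signs below come from \<open>g(y, e\<^sub>4) = - y\<^sup>4\<close>.\<close>

definition koszul_form :: "real \<Rightarrow> real \<Rightarrow> 'v tensor3"
  where "koszul_form a b x y z = weight_form a b x z * coord 4 y - weight_form a b x y * coord 4 z"

lemma koszul_form_linear:
  "linear_over V (\<lambda>u. koszul_form a b u y z)"
  "linear_over V (koszul_form a b x y)"
  unfolding linear_over_def by (auto simp: koszul_form_def weight_form_def coord_lin real_algebra)

lemma koszul_form_skew: "koszul_form a b x z y = - koszul_form a b x y z"
  by (simp add: koszul_form_def)

end

context almost_complex_space
begin

text \<open>The fundamental tensor \<open>g((\<nabla>\<^sub>x J) y, z)\<close> on left-invariant fields, where the term
  \<open>- g(J \<nabla>\<^sub>x y, z)\<close> is rewritten with the adjoint \<open>- \<epsilon> J\<close> of \<open>J\<close>.\<close>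

definition structure_tensor :: "real \<Rightarrow> real \<Rightarrow> 'v tensor3"
  where "structure_tensor a b x y z = koszul_form a b x (J y) z + \<epsilon> * koszul_form a b x y (J z)"

text \<open>The symmetries come from the skewness of \<open>koszul_form\<close> in its last two arguments, together with
  \<open>J\<^sup>2 = -1\<close> and \<open>\<epsilon>\<^sup>2 = 1\<close>.\<close>

lemma structure_tensor_fundamental: "structure_tensor a b \<in> fundamental_tensors \<epsilon> V J"
proof -
  have "structure_tensor a b x y z = - \<epsilon> * structure_tensor a b x z y"
    "structure_tensor a b x y z = - \<epsilon> * structure_tensor a b x (J y) (J z)"
    if "x \<in> V" "y \<in> V" "z \<in> V" for x y z
  proof -
    have neg: "koszul_form a b x (- y) w = - koszul_form a b x y w"
      "koszul_form a b x v (- z) = - koszul_form a b x v z" for v w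
      using that by (simp_all add: koszul_form_def weight_form_def coord_lin real_algebra)
    have e: "\<epsilon> * (\<epsilon> * c) = c" for c using \<epsilon>_sq by (simp add: mult.assoc[symmetric])
    show "structure_tensor a b x y z = - \<epsilon> * structure_tensor a b x z y"
      using koszul_form_skew[of a b x z "J y"] koszul_form_skew[of a b x y "J z"]
      by (simp add: structure_tensor_def right_diff_distrib e)
    show "structure_tensor a b x y z = - \<epsilon> * structure_tensor a b x (J y) (J z)"
      using that by (simp add: structure_tensor_def right_diff_distrib e neg)
  qed
  then show ?thesis
    unfolding fundamental_tensors_def trilinear_over_def linear_over_def
    by (auto simp: structure_tensor_def koszul_form_def weight_form_def coord_lin J_lin real_algebra)
qed

lemma coord_J_adjoint: "x \<in> V \<Longrightarrow> coord i (J x) = - \<epsilon> * (neutral_sign i * g x (J (e i)))"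
  by (simp add: coord_def J_adjoint)

lemma metric_frame: "x \<in> V \<Longrightarrow> g x (e i) = neutral_sign i * coord i x"
  by (simp add: coord_def)

end

lemma (in hermitian_space) coord_J:
  assumes "x \<in> V"
  shows "coord 1 (J x) = - coord 2 x" "coord 2 (J x) = coord 1 x"
    "coord 3 (J x) = coord 4 x" "coord 4 (J x) = - coord 3 x"
  using assms by (simp_all add: coord_J_adjoint J_frame J_frame' metric_lin metric_frame)

lemma (in hermitian_space) lee_form_structure_tensor:
  "z \<in> V \<Longrightarrow> lee_form g e (structure_tensor a b) z = (1 + a) * coord 3 z"
  by (simp add: lee_form_frame sum_4 structure_tensor_def koszul_form_def weight_form_def coord_J real_algebra)

text \<open>For general parameters the structure tensor differs from its Lee part by components that are multiples
  of \<open>1 - a\<close>.\<close>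

lemma (in hermitian_space) structure_tensor_W4: "structure_tensor 1 b \<in> hermitian_W4 V g e J"
  using structure_tensor_fundamental[of 1 b]
  by (simp add: hermitian_W4_def lee_form_structure_tensor structure_tensor_def koszul_form_def
      weight_form_def coord_J metric_coord real_algebra)

locale norden_space_J2 = norden_space +
  assumes J_frame: "J (e 1) = e 3" "J (e 2) = e 4"
begin

lemma coord_J:
  assumes "x \<in> V"
  shows "coord 1 (J x) = - coord 3 x" "coord 2 (J x) = - coord 4 x"
    "coord 3 (J x) = coord 1 x" "coord 4 (J x) = coord 2 x"
proof -
  have J2: "J (e 3) = - e 1" "J (e 4) = - e 2"
    using J_J[of "e 1"] J_J[of "e 2"] by (simp_all add: J_frame)
  show "coord 1 (J x) = - coord 3 x" "coord 2 (J x) = - coord 4 x"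
    "coord 3 (J x) = coord 1 x" "coord 4 (J x) = coord 2 x"
    using assms by (simp_all add: coord_J_adjoint J2 J_frame metric_lin metric_frame)
qed

lemma lee_form_structure_tensor:
  "z \<in> V \<Longrightarrow> lee_form g e (structure_tensor a b) z = (1 + 2 * a + b) * coord 2 z"
  by (simp add: lee_form_frame sum_4 structure_tensor_def koszul_form_def weight_form_def coord_J real_algebra)

text \<open>For general parameters the components of this form are multiples of \<open>b - 1\<close>.\<close>

lemma nijenhuis_form_structure_tensor:
  "x \<in> V \<Longrightarrow> y \<in> V \<Longrightarrow> z \<in> V \<Longrightarrow> nijenhuis_form (structure_tensor a 1) x y z = 0"
  by (simp add: nijenhuis_form_def cyclic_sum_def structure_tensor_def koszul_form_def weight_form_def
      coord_J coord_lin real_algebra)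

text \<open>Here \<open>S\<close> is the identity on the span of \<open>e\<^sub>1, e\<^sub>2, e\<^sub>3\<close>, so \<open>koszul_form\<close> becomes
  \<open>g(x, z) y\<^sup>4 - g(x, y) z\<^sup>4\<close>. Like a Lee part, it is built from the metric and a single 1-form.\<close>

lemma structure_tensor_W1: "structure_tensor 1 1 \<in> norden_W1 V g e J"
  using structure_tensor_fundamental[of 1 1]
  by (simp add: norden_W1_def lee_form_structure_tensor structure_tensor_def koszul_form_def
      weight_form_def coord_J metric_coord real_algebra)

end

locale norden_space_J3 = norden_space +
  assumes J_frame: "J (e 1) = - e 4" "J (e 2) = e 3"
begin

lemma coord_J:
  assumes "x \<in> V"
  shows "coord 1 (J x) = coord 4 x" "coord 2 (J x) = - coord 3 x"
    "coord 3 (J x) = coord 2 x" "coord 4 (J x) = - coord 1 x"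
proof -
  have J2: "J (e 3) = - e 2" "J (e 4) = e 1"
    using J_J[of "e 1"] J_J[of "e 2"] by (simp_all add: J_frame J_lin(2))
  show "coord 1 (J x) = coord 4 x" "coord 2 (J x) = - coord 3 x"
    "coord 3 (J x) = coord 2 x" "coord 4 (J x) = - coord 1 x"
    using assms by (simp_all add: coord_J_adjoint J2 J_frame metric_lin metric_frame)
qed

lemma lee_form_structure_tensor:
  "z \<in> V \<Longrightarrow> lee_form g e (structure_tensor a b) z = - (2 + a + b) * coord 1 z"
  by (simp add: lee_form_frame sum_4 structure_tensor_def koszul_form_def weight_form_def coord_J real_algebra)

text \<open>For general parameters the components of this form are multiples of \<open>b - a\<close>.\<close>

lemma nijenhuis_form_structure_tensor:
  "x \<in> V \<Longrightarrow> y \<in> V \<Longrightarrow> z \<in> V \<Longrightarrow> nijenhuis_form (structure_tensor a a) x y z = 0"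
  by (simp add: nijenhuis_form_def cyclic_sum_def structure_tensor_def koszul_form_def weight_form_def
      coord_J coord_lin real_algebra)

end

section \<open>The Levi-Civita connection and the fundamental tensors\<close>

locale g45_lie_group =
  fixes L :: "('a::{t2_space,second_countable_topology}) monoid"
    and A :: "('a, real^4) atlas"
    and a b :: real
    and E :: "4 \<Rightarrow> 'a vfield"
    and J1 J2 J3 :: "'a endo_field"
    and g :: "'a metric_field"
    and D :: "'a connection"
  assumes lie: "lie_group L A"
    and frame: "has_lie_algebra_g45 L A a b E"
    and struct: "hermitian_norden_structure A E J1 J2 J3 g"
    and conn: "levi_civita_connection A g D"
begin

lemma manifold: "smooth_manifold A"
  using lie by (simp add: lie_group_def)

lemma E_vfield [simp]: "E i \<in> vfields A"
  using frame by (simp add: has_lie_algebra_g45_def left_invariant_def)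

lemma E_tangent [simp]: "E i p \<in> tangent_space A p"
  by (rule vfields_tangent) simp

lemma metric: "pseudo_riemannian_metric A g"
  using struct by (simp add: hermitian_norden_structure_def)

lemma metric_smooth: "X \<in> vfields A \<Longrightarrow> Y \<in> vfields A \<Longrightarrow> (\<lambda>p. g p (X p) (Y p)) \<in> smooth_funs A"
  using metric by (simp add: pseudo_riemannian_metric_def)

lemma frame_gram: "g p (E i p) (E j p) = (if i = j then neutral_sign i else 0)"
proof -
  have *: "E k p = (\<Sum>l\<in>UNIV. ((axis k 1 :: real^4) $ l) *\<^sub>R E l p)" for k
    by (simp add: axis_def if_distrib[of "\<lambda>r. r *\<^sub>R _"] cong: if_cong)
  have "g p (E i p) (E j p) = (axis i 1 :: real^4) $ 1 * (axis j 1 :: real^4) $ 1 +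
      (axis i 1 :: real^4) $ 2 * (axis j 1 :: real^4) $ 2 -
      (axis i 1 :: real^4) $ 3 * (axis j 1 :: real^4) $ 3 -
      (axis i 1 :: real^4) $ 4 * (axis j 1 :: real^4) $ 4"
    using struct unfolding hermitian_norden_structure_def by (subst (1 2) *) blast
  then show ?thesis
    using exhaust_4[of i] exhaust_4[of j] by (auto simp: axis_def)
qed

sublocale neutral_space "tangent_space A p" "g p" "\<lambda>i. E i p" for p
proof
  show "\<exists>c. x = (\<Sum>i\<in>UNIV. c i *\<^sub>R E i p)" if "x \<in> tangent_space A p" for x
    using left_invariant_frame_spans[OF lie _ _ that, of E] frame
    by (simp add: has_lie_algebra_g45_def)
  show "linear_over (tangent_space A p) (g p x)" if "x \<in> tangent_space A p" for x
    using metric that by (simp add: pseudo_riemannian_metric_def)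
  show "g p x y = g p y x" if "x \<in> tangent_space A p" "y \<in> tangent_space A p" for x y
    using metric that by (simp add: pseudo_riemannian_metric_def)
qed (simp_all add: subspace_tangent_space frame_gram)

text \<open>The eigenvalues of \<open>S = [\<cdot>, e\<^sub>4]\<close> on the frame.\<close>

definition weight :: "4 \<Rightarrow> real"
  where "weight i = (if i = 1 then 1 else if i = 2 then a else if i = 3 then b else 0)"

lemma frame_bracket:
  "lie_bracket (E i) (E j) p
     = (if j = 4 then weight i else 0) *\<^sub>R E i p - (if i = 4 then weight j else 0) *\<^sub>R E j p"
proof -
  have skew: "lie_bracket (E i) (E j) = - lie_bracket (E j) (E i)" for i j
    by (simp add: lie_bracket_def fun_eq_iff)
  have self: "lie_bracket (E i) (E i) = 0" for i
    by (simp add: lie_bracket_def fun_eq_iff)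
  have B: "lie_bracket (E 1) (E 4) = E 1" "lie_bracket (E 2) (E 4) = a *\<^sub>R E 2"
    "lie_bracket (E 3) (E 4) = b *\<^sub>R E 3" "lie_bracket (E 1) (E 2) = 0"
    "lie_bracket (E 1) (E 3) = 0" "lie_bracket (E 2) (E 3) = 0"
    using frame by (simp_all add: has_lie_algebra_g45_def)
  have B': "lie_bracket (E 4) (E 1) = - E 1" "lie_bracket (E 4) (E 2) = - (a *\<^sub>R E 2)"
    "lie_bracket (E 4) (E 3) = - (b *\<^sub>R E 3)" "lie_bracket (E 2) (E 1) = 0"
    "lie_bracket (E 3) (E 1) = 0" "lie_bracket (E 3) (E 2) = 0"
    using skew[of 4 1] skew[of 4 2] skew[of 4 3] skew[of 2 1] skew[of 3 1] skew[of 3 2]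
    by (simp_all add: B)
  show ?thesis
    using exhaust_4[of i] exhaust_4[of j]
    by (auto simp: self B B' weight_def fun_eq_iff scaleR_fun_def)
qed

lemma D_vfield [simp]: "X \<in> vfields A \<Longrightarrow> Y \<in> vfields A \<Longrightarrow> D X Y \<in> vfields A"
  using conn by (simp add: levi_civita_connection_def affine_connection_def)

lemma D_tangent [simp]: "X \<in> vfields A \<Longrightarrow> Y \<in> vfields A \<Longrightarrow> D X Y p \<in> tangent_space A p"
  by (intro vfields_tangent D_vfield)

lemma D_metric:
  assumes "X \<in> vfields A" "Y \<in> vfields A" "Z \<in> vfields A"
  shows "X p (\<lambda>q. g q (Y q) (Z q)) = g p (D X Y p) (Z p) + g p (Y p) (D X Z p)"
  using conn assms unfolding levi_civita_connection_def by blast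

text \<open>The frame has constant metric coefficients, so its connection coefficients \<open>N\<close> are skew in the last
  two indices, and their skew part in the first two is given by the brackets. These two conditions
  determine \<open>N\<close> by the usual cyclic permutation of the indices.\<close>

lemma D_frame:
  "g p (D (E i) (E j) p) (E k p) = koszul_form p a b (E i p) (E j p) (E k p)"
proof -
  define N where "N i j k = g p (D (E i) (E j) p) (E k p)" for i j k
  define C where "C i j k = g p (lie_bracket (E i) (E j) p) (E k p)" for i j k
  have skew: "N i j k + N i k j = 0" for i j k
  proof -
    have "E i p (\<lambda>q. g q (E j q) (E k q)) = 0"
      unfolding frame_gram by (rule tangent_vector_const[OF E_tangent])
    moreover have "g p (E j p) (D (E i) (E k) p) = N i k j"
      unfolding N_def by (rule metric_sym) simp_all
    ultimately show ?thesis
      using D_metric[OF E_vfield E_vfield E_vfield, of i p j k] by (simp add: N_def)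
  qed
  have tors: "N i j k - N j i k = C i j k" for i j k
  proof -
    have "D (E i) (E j) - D (E j) (E i) = lie_bracket (E i) (E j)"
      using conn unfolding levi_civita_connection_def by simp
    then have "lie_bracket (E i) (E j) p = D (E i) (E j) p - D (E j) (E i) p"
      by (metis fun_diff_def)
    then show ?thesis unfolding N_def C_def
      by (simp only:) (simp add: metric_diff del: fun_diff_def)
  qed
  have "2 * N i j k = C i j k - C j k i + C k i j"
    using skew[of i j k] skew[of j k i] skew[of k i j] tors[of i j k] tors[of j k i] tors[of k i j]
    by linarith
  moreover have "C i j k = (if j = 4 \<and> i = k then weight i * neutral_sign k else 0)
      - (if i = 4 \<and> j = k then weight j * neutral_sign k else 0)" for i j k
    unfolding C_def frame_bracket by (simp only: metric_comb[OF E_tangent E_tangent E_tangent] frame_gram) auto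
  ultimately have "2 * N i j k = 2 * koszul_form p a b (E i p) (E j p) (E k p)"
    using exhaust_4[of i] exhaust_4[of j] exhaust_4[of k]
    by (auto simp: koszul_form_def weight_form_def weight_def)
  then show ?thesis by (simp add: N_def)
qed

lemma smooth_coord: "X \<in> vfields A \<Longrightarrow> (\<lambda>p. coord p i (X p)) \<in> smooth_funs A"
  unfolding coord_def
  by (intro smooth_funs_mult[OF manifold] smooth_funs_const metric_smooth E_vfield)

lemma vfield_expansion:
  assumes "X \<in> vfields A"
  shows "X = (\<Sum>i\<in>UNIV. vfield_scale (\<lambda>p. coord p i (X p)) (E i))"
proof
  fix p
  show "X p = (\<Sum>i\<in>UNIV. vfield_scale (\<lambda>p. coord p i (X p)) (E i)) p"
    using frame_expansion[OF vfields_tangent[OF assms]] by (simp add: sum_fun_apply vfield_scale_def)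
qed

text \<open>Both sides are tensorial in the direction \<open>X\<close>, which reduces the claim to the frame.\<close>

lemma D_vfield_frame:
  assumes X: "X \<in> vfields A" and z: "z \<in> tangent_space A p"
  shows "g p (D X (E j) p) z = koszul_form p a b (X p) (E j p) z"
proof (rule linear_over_eqI[OF _ koszul_form_linear(2) _ z, of "g p (D X (E j) p)"])
  show "linear_over (tangent_space A p) (g p (D X (E j) p))"
    using X by (intro metric_linear) simp
  fix k
  let ?c = "\<lambda>i p. coord p i (X p)"
  have "affine_connection A D" using conn by (simp add: levi_civita_connection_def)
  from connection_sum_left[OF manifold this E_vfield finite_class.finite_UNIV smooth_coord[OF X] E_vfield]
  have "D (\<Sum>i\<in>UNIV. vfield_scale (?c i) (E i)) (E j)
      = (\<Sum>i\<in>UNIV. vfield_scale (?c i) (D (E i) (E j)))" .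
  then have "D X (E j) = (\<Sum>i\<in>UNIV. vfield_scale (?c i) (D (E i) (E j)))"
    unfolding vfield_expansion[OF X, symmetric] .
  then have "D X (E j) p = (\<Sum>i\<in>UNIV. ?c i p *\<^sub>R D (E i) (E j) p)"
    by (simp add: sum_fun_apply vfield_scale_def)
  then have "g p (D X (E j) p) (E k p) = (\<Sum>i\<in>UNIV. ?c i p *\<^sub>R g p (D (E i) (E j) p) (E k p))"
    using linear_over_sum[OF metric_linear_left[OF E_tangent] subspace_tangent_space,
        of "\<lambda>i. D (E i) (E j) p" p UNIV "\<lambda>i. ?c i p" k] by simp
  also have "\<dots> = koszul_form p a b (X p) (E j p) (E k p)"
    using linear_over_expand[OF koszul_form_linear(1) vfields_tangent[OF X]] by (simp add: D_frame)
  finally show "g p (D X (E j) p) (E k p) = koszul_form p a b (X p) (E j p) (E k p)" .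
qed

text \<open>Metric compatibility moves the derivative from \<open>Y\<close> to the frame, which avoids expanding \<open>Y\<close> in
  the frame and applying the Leibniz rule. The first term on the right is the only one that is not
  tensorial in \<open>Y\<close>.\<close>

lemma D_vfields:
  assumes X: "X \<in> vfields A" and Y: "Y \<in> vfields A"
  shows "g p (D X Y p) (E k p) = X p (\<lambda>q. g q (Y q) (E k q)) + koszul_form p a b (X p) (Y p) (E k p)"
proof -
  have "g p (Y p) (D X (E k) p) = g p (D X (E k) p) (Y p)"
    using X Y by (intro metric_sym) (simp_all add: vfields_tangent)
  also have "\<dots> = - koszul_form p a b (X p) (Y p) (E k p)"
    using D_vfield_frame[OF X vfields_tangent[OF Y]] by (simp add: koszul_form_skew[of p a b "X p" "Y p"])
  finally show ?thesis using D_metric[OF X Y E_vfield, of p k] by simp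
qed

text \<open>Each of the three structures permutes the frame up to signs. Allowing arbitrary factors avoids naming
  the permutation and the signs; what matters is that the factors are constant on the group.\<close>

context
  fixes J :: "'a endo_field" and \<epsilon> :: real
  assumes J: "almost_complex_structure A J"
    and J_frame: "\<And>k. \<exists>c l. endo_app J (E k) = c *\<^sub>R E l"
    and J_frame_metric: "\<And>i j p. g p (J p (E i p)) (J p (E j p)) = \<epsilon> * g p (E i p) (E j p)"
    and \<epsilon>_sq: "\<epsilon> * \<epsilon> = 1"
begin

text \<open>The relation between \<open>J\<close> and \<open>g\<close> holds on the frame, hence everywhere by linearity.\<close>

lemma almost_complex_space_at:
  "almost_complex_space (tangent_space A p) (g p) (\<lambda>i. E i p) (J p) \<epsilon>"
proof
  let ?T = "tangent_space A p"
  show lin: "linear_over ?T (J p)" and JT: "\<And>x. x \<in> ?T \<Longrightarrow> J p x \<in> ?T"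
    and "\<And>x. x \<in> ?T \<Longrightarrow> J p (J p x) = - x"
    using J unfolding almost_complex_structure_def by auto
  show "\<epsilon> * \<epsilon> = 1" by (rule \<epsilon>_sq)
  have J_lin: "J p (c *\<^sub>R x + y) = c *\<^sub>R J p x + J p y" if "x \<in> ?T" "y \<in> ?T" for c x y
    by (rule linear_overD[OF lin that])
  have 1: "g p (J p (E i p)) (J p y) = \<epsilon> * g p (E i p) y" if "y \<in> ?T" for i y
    by (rule linear_over_eqI[OF _ _ _ that])
      (simp_all add: linear_over_def J_lin JT metric_lin J_frame_metric real_algebra)
  show "g p (J p x) (J p y) = \<epsilon> * g p x y" if "x \<in> ?T" "y \<in> ?T" for x y
    by (rule linear_over_eqI[OF _ _ _ that(1), of "\<lambda>x. g p (J p x) (J p y)"])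
      (simp_all add: linear_over_def J_lin JT metric_lin 1 that real_algebra)
qed

abbreviation model_tensor :: "'a \<Rightarrow> 'a tvec tensor3"
  where "model_tensor p \<equiv> almost_complex_space.structure_tensor (g p) (\<lambda>i. E i p) (J p) \<epsilon> a b"

text \<open>Since \<open>J\<close> has constant coefficients, \<open>g(J Y, E\<^sub>k)\<close> is the constant multiple of \<open>g(Y, E\<^sub>l)\<close>
  that the adjoint of \<open>J\<close> prescribes. The derivatives of these functions, which are the
  non-tensorial terms of \<open>\<nabla>\<^sub>X(J Y)\<close> and \<open>J \<nabla>\<^sub>X Y\<close>, therefore cancel.\<close>

lemma fundamental_tensor_frame:
  assumes X: "X \<in> vfields A" and Y: "Y \<in> vfields A"
  shows "fundamental_tensor g D J X Y (E k) p = model_tensor p (X p) (Y p) (E k p)"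
proof -
  have JY: "endo_app J Y \<in> vfields A" using J Y by (simp add: almost_complex_structure_def)
  interpret ac: almost_complex_space "tangent_space A q" "g q" "\<lambda>i. E i q" "J q" \<epsilon> for q
    by (rule almost_complex_space_at)
  obtain c l where "endo_app J (E k) = c *\<^sub>R E l" using J_frame by blast
  then have JE: "J q (E k q) = c *\<^sub>R E l q" for q
    by (metis endo_app_def scaleR_fun_def)
  have adj: "g q (J q x) (E k q) = (- \<epsilon> * c) * g q x (E l q)" if "x \<in> tangent_space A q" for q x
    using ac.J_adjoint[OF that E_tangent, of k]
      linear_over_scale[OF metric_linear[OF that] subspace_tangent_space, of "E l q" c]
    by (simp add: JE)
  have kos: "koszul_form p a b (X p) (Y p) (c *\<^sub>R E l p) = c * koszul_form p a b (X p) (Y p) (E l p)"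
    using linear_over_scale[OF koszul_form_linear(2) subspace_tangent_space, of "E l p" p a b "X p" "Y p" c]
    by simp
  have der: "X p (\<lambda>q. g q (endo_app J Y q) (E k q)) = (- \<epsilon> * c) * X p (\<lambda>q. g q (Y q) (E l q))"
    using tangent_vector_cmult[OF vfields_tangent[OF X] metric_smooth[OF Y E_vfield], of p "- \<epsilon> * c" l]
    by (simp add: endo_app_def adj[OF vfields_tangent[OF Y]])
  have "fundamental_tensor g D J X Y (E k) p
      = g p (D X (endo_app J Y) p) (E k p) - g p (J p (D X Y p)) (E k p)"
    using X Y JY by (simp add: fundamental_tensor_def endo_app_def metric_diff)
  also have "\<dots> = koszul_form p a b (X p) (J p (Y p)) (E k p)
      + \<epsilon> * koszul_form p a b (X p) (Y p) (J p (E k p))"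
    using X Y D_vfields[OF X JY, of p k] D_vfields[OF X Y, of p l]
    by (simp add: adj der[unfolded endo_app_def] JE kos endo_app_def algebra_simps)
  finally show ?thesis by (simp add: ac.structure_tensor_def)
qed

lemma fundamental_tensor_eq_model:
  assumes X: "X \<in> vfields A" and Y: "Y \<in> vfields A" and Z: "Z \<in> vfields A"
  shows "fundamental_tensor g D J X Y Z p = model_tensor p (X p) (Y p) (Z p)"
proof -
  interpret ac: almost_complex_space "tangent_space A p" "g p" "\<lambda>i. E i p" "J p" \<epsilon>
    by (rule almost_complex_space_at)
  let ?w = "(D X (endo_app J Y) - endo_app J (D X Y)) p"
  have JV: "endo_app J W \<in> vfields A" if "W \<in> vfields A" for W
    using J that by (simp add: almost_complex_structure_def)
  have w: "?w \<in> tangent_space A p"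
    using subspace_diff[OF subspace_tangent_space vfields_tangent vfields_tangent,
        OF D_vfield[OF X JV[OF Y]] JV[OF D_vfield[OF X Y]]] by simp
  have "g p ?w (Z p) = model_tensor p (X p) (Y p) (Z p)"
  proof (rule linear_over_eqI[OF metric_linear[OF w] _ _ vfields_tangent[OF Z]])
    show "linear_over (tangent_space A p) (model_tensor p (X p) (Y p))"
      using ac.structure_tensor_fundamental[of a b] vfields_tangent[OF X] vfields_tangent[OF Y]
      by (simp add: fundamental_tensors_def trilinear_over_def)
    show "g p ?w (E k p) = model_tensor p (X p) (Y p) (E k p)" for k
      using fundamental_tensor_frame[OF X Y] by (simp add: fundamental_tensor_def)
  qed
  then show ?thesis by (simp add: fundamental_tensor_def)
qed

lemma belongs_to_of_model:
  assumes "\<And>p. model_tensor p \<in> C p"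
  shows "belongs_to A g D J C"
  unfolding belongs_to_def using assms fundamental_tensor_eq_model by blast

end

section \<open>The classes of the three structures\<close>

lemma structures:
  "almost_complex_structure A J1" "almost_complex_structure A J2" "almost_complex_structure A J3"
  "J1 p (E 1 p) = E 2 p" "J1 p (E 2 p) = - E 1 p" "J1 p (E 3 p) = - E 4 p" "J1 p (E 4 p) = E 3 p"
  "J2 p (E 1 p) = E 3 p" "J2 p (E 2 p) = E 4 p" "J2 p (E 3 p) = - E 1 p" "J2 p (E 4 p) = - E 2 p"
  "J3 p (E 1 p) = - E 4 p" "J3 p (E 2 p) = E 3 p" "J3 p (E 3 p) = - E 2 p" "J3 p (E 4 p) = E 1 p"
  using struct unfolding hermitian_norden_structure_def endo_app_def by (auto simp: fun_eq_iff)

lemma frame_permuted: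
  "\<exists>c l. endo_app J1 (E k) = c *\<^sub>R E l" "\<exists>c l. endo_app J2 (E k) = c *\<^sub>R E l"
  "\<exists>c l. endo_app J3 (E k) = c *\<^sub>R E l"
proof -
  have pm: "\<exists>c l. E i = c *\<^sub>R E l" "\<exists>c l. - E i = c *\<^sub>R E l" for i
    by (rule exI[of _ 1], rule exI[of _ i], simp) (rule exI[of _ "-1"], rule exI[of _ i], simp)
  show "\<exists>c l. endo_app J1 (E k) = c *\<^sub>R E l" "\<exists>c l. endo_app J2 (E k) = c *\<^sub>R E l"
    "\<exists>c l. endo_app J3 (E k) = c *\<^sub>R E l"
    using struct exhaust_4[of k] pm unfolding hermitian_norden_structure_def by metis+
qed

lemma frame_metric:
  "g p (J1 p (E i p)) (J1 p (E j p)) = 1 * g p (E i p) (E j p)"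
  "g p (J2 p (E i p)) (J2 p (E j p)) = - 1 * g p (E i p) (E j p)"
  "g p (J3 p (E i p)) (J3 p (E j p)) = - 1 * g p (E i p) (E j p)"
  using exhaust_4[of i] exhaust_4[of j] by (auto simp: structures metric_lin frame_gram)

lemma hermitian_J1: "hermitian_space (tangent_space A p) (g p) (\<lambda>i. E i p) (J1 p)"
proof -
  interpret almost_complex_space "tangent_space A p" "g p" "\<lambda>i. E i p" "J1 p" 1
    by (rule almost_complex_space_at[OF structures(1) frame_permuted(1) frame_metric(1)]) simp
  show ?thesis by unfold_locales (simp_all add: structures)
qed

lemma norden_J2: "norden_space_J2 (tangent_space A p) (g p) (\<lambda>i. E i p) (J2 p)"
proof -
  interpret almost_complex_space "tangent_space A p" "g p" "\<lambda>i. E i p" "J2 p" "-1"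
    by (rule almost_complex_space_at[OF structures(2) frame_permuted(2) frame_metric(2)]) simp
  show ?thesis by unfold_locales (simp_all add: structures sum_4 metric_lin frame_gram)
qed

lemma norden_J3: "norden_space_J3 (tangent_space A p) (g p) (\<lambda>i. E i p) (J3 p)"
proof -
  interpret almost_complex_space "tangent_space A p" "g p" "\<lambda>i. E i p" "J3 p" "-1"
    by (rule almost_complex_space_at[OF structures(3) frame_permuted(3) frame_metric(3)]) simp
  show ?thesis by unfold_locales (simp_all add: structures sum_4 metric_lin frame_gram)
qed

lemmas belongs_J1 = belongs_to_of_model[OF structures(1) frame_permuted(1) frame_metric(1)]
lemmas belongs_J2 = belongs_to_of_model[OF structures(2) frame_permuted(2) frame_metric(2)]
lemmas belongs_J3 = belongs_to_of_model[OF structures(3) frame_permuted(3) frame_metric(3)]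

lemma J1_classes:
  shows "belongs_to A g D J1 (\<lambda>p. hermitian_W2 (tangent_space A p) (J1 p)
      + hermitian_W4 (tangent_space A p) (g p) (\<lambda>i. E i p) (J1 p))"
    and "a = -1 \<Longrightarrow> belongs_to A g D J1 (\<lambda>p. hermitian_W2 (tangent_space A p) (J1 p))"
    and "a = 1 \<Longrightarrow> belongs_to A g D J1 (\<lambda>p. hermitian_W4 (tangent_space A p) (g p) (\<lambda>i. E i p) (J1 p))"
proof -
  interpret J: hermitian_space "tangent_space A p" "g p" "\<lambda>i. E i p" "J1 p" for p
    by (rule hermitian_J1)
  note F = J.structure_tensor_fundamental[of _ a b]
  show "belongs_to A g D J1 (\<lambda>p. hermitian_W2 (tangent_space A p) (J1 p)
      + hermitian_W4 (tangent_space A p) (g p) (\<lambda>i. E i p) (J1 p))"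
    by (rule belongs_J1) (simp_all add: J.hermitian_W2_W4[OF F])
  show "belongs_to A g D J1 (\<lambda>p. hermitian_W2 (tangent_space A p) (J1 p))" if "a = -1"
    by (rule belongs_J1) (simp, rule J.hermitian_W2I[OF F], use that J.lee_form_structure_tensor in simp)
  show "belongs_to A g D J1 (\<lambda>p. hermitian_W4 (tangent_space A p) (g p) (\<lambda>i. E i p) (J1 p))" if "a = 1"
    using that by (intro belongs_J1) (simp_all add: J.structure_tensor_W4)
qed

lemma J2_classes:
  shows "belongs_to A g D J2 (\<lambda>p. norden_W1 (tangent_space A p) (g p) (\<lambda>i. E i p) (J2 p)
      + norden_W2 (tangent_space A p) (g p) (\<lambda>i. E i p) (J2 p) + norden_W3 (tangent_space A p) (J2 p))"
    and "b = 1 \<Longrightarrow> belongs_to A g D J2 (\<lambda>p. norden_W1 (tangent_space A p) (g p) (\<lambda>i. E i p) (J2 p)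
      + norden_W2 (tangent_space A p) (g p) (\<lambda>i. E i p) (J2 p))"
    and "1 + 2 * a + b = 0 \<Longrightarrow> belongs_to A g D J2 (\<lambda>p.
      norden_W2 (tangent_space A p) (g p) (\<lambda>i. E i p) (J2 p) + norden_W3 (tangent_space A p) (J2 p))"
    and "b = 1 \<Longrightarrow> a = -1 \<Longrightarrow> belongs_to A g D J2 (\<lambda>p. norden_W2 (tangent_space A p) (g p) (\<lambda>i. E i p) (J2 p))"
    and "b = 1 \<Longrightarrow> a = 1 \<Longrightarrow> belongs_to A g D J2 (\<lambda>p. norden_W1 (tangent_space A p) (g p) (\<lambda>i. E i p) (J2 p))"
proof -
  interpret J: norden_space_J2 "tangent_space A p" "g p" "\<lambda>i. E i p" "J2 p" for p
    by (rule norden_J2)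
  note F = J.structure_tensor_fundamental[of _ a b]
  note \<theta> = J.lee_form_structure_tensor and \<omega> = J.nijenhuis_form_structure_tensor
  show "belongs_to A g D J2 (\<lambda>p. norden_W1 (tangent_space A p) (g p) (\<lambda>i. E i p) (J2 p)
      + norden_W2 (tangent_space A p) (g p) (\<lambda>i. E i p) (J2 p) + norden_W3 (tangent_space A p) (J2 p))"
    by (rule belongs_J2) (simp_all add: J.norden_W1_W2_W3[OF F])
  show "belongs_to A g D J2 (\<lambda>p. norden_W1 (tangent_space A p) (g p) (\<lambda>i. E i p) (J2 p)
      + norden_W2 (tangent_space A p) (g p) (\<lambda>i. E i p) (J2 p))" if "b = 1"
    by (rule belongs_J2) (simp, rule J.norden_W1_W2[OF F], use that \<omega> in simp)
  show "belongs_to A g D J2 (\<lambda>p. norden_W2 (tangent_space A p) (g p) (\<lambda>i. E i p) (J2 p)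
      + norden_W3 (tangent_space A p) (J2 p))" if "1 + 2 * a + b = 0"
    by (rule belongs_J2) (simp, rule J.norden_W2_W3[OF F], use that \<theta> in simp)
  show "belongs_to A g D J2 (\<lambda>p. norden_W2 (tangent_space A p) (g p) (\<lambda>i. E i p) (J2 p))"
    if "b = 1" "a = -1"
    by (rule belongs_J2) (simp, rule J.norden_W2I[OF F], use that \<theta> \<omega> in simp_all)
  show "belongs_to A g D J2 (\<lambda>p. norden_W1 (tangent_space A p) (g p) (\<lambda>i. E i p) (J2 p))"
    if "b = 1" "a = 1"
    by (rule belongs_J2) (use that J.structure_tensor_W1 in simp_all)
qed

lemma J3_classes:
  shows "belongs_to A g D J3 (\<lambda>p. norden_W1 (tangent_space A p) (g p) (\<lambda>i. E i p) (J3 p)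
      + norden_W2 (tangent_space A p) (g p) (\<lambda>i. E i p) (J3 p) + norden_W3 (tangent_space A p) (J3 p))"
    and "a = b \<Longrightarrow> belongs_to A g D J3 (\<lambda>p. norden_W1 (tangent_space A p) (g p) (\<lambda>i. E i p) (J3 p)
      + norden_W2 (tangent_space A p) (g p) (\<lambda>i. E i p) (J3 p))"
    and "2 + a + b = 0 \<Longrightarrow> belongs_to A g D J3 (\<lambda>p.
      norden_W2 (tangent_space A p) (g p) (\<lambda>i. E i p) (J3 p) + norden_W3 (tangent_space A p) (J3 p))"
    and "a = b \<Longrightarrow> b = -1 \<Longrightarrow> belongs_to A g D J3 (\<lambda>p. norden_W2 (tangent_space A p) (g p) (\<lambda>i. E i p) (J3 p))"
proof -
  interpret J: norden_space_J3 "tangent_space A p" "g p" "\<lambda>i. E i p" "J3 p" for p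
    by (rule norden_J3)
  note F = J.structure_tensor_fundamental[of _ a b]
  note \<theta> = J.lee_form_structure_tensor and \<omega> = J.nijenhuis_form_structure_tensor
  show "belongs_to A g D J3 (\<lambda>p. norden_W1 (tangent_space A p) (g p) (\<lambda>i. E i p) (J3 p)
      + norden_W2 (tangent_space A p) (g p) (\<lambda>i. E i p) (J3 p) + norden_W3 (tangent_space A p) (J3 p))"
    by (rule belongs_J3) (simp_all add: J.norden_W1_W2_W3[OF F])
  show "belongs_to A g D J3 (\<lambda>p. norden_W1 (tangent_space A p) (g p) (\<lambda>i. E i p) (J3 p)
      + norden_W2 (tangent_space A p) (g p) (\<lambda>i. E i p) (J3 p))" if "a = b"
    by (rule belongs_J3) (simp, rule J.norden_W1_W2[OF F], use that \<omega> in simp)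
  show "belongs_to A g D J3 (\<lambda>p. norden_W2 (tangent_space A p) (g p) (\<lambda>i. E i p) (J3 p)
      + norden_W3 (tangent_space A p) (J3 p))" if "2 + a + b = 0"
    by (rule belongs_J3) (simp, rule J.norden_W2_W3[OF F], use that \<theta> in simp)
  show "belongs_to A g D J3 (\<lambda>p. norden_W2 (tangent_space A p) (g p) (\<lambda>i. E i p) (J3 p))"
    if "a = b" "b = -1"
    by (rule belongs_J3) (simp, rule J.norden_W2I[OF F], use that \<theta> \<omega> in simp_all)
qed

end

theorem theorem3p1:
  fixes L :: "('a::{t2_space,second_countable_topology}) monoid"
    and A :: "('a, real^4) atlas"
    and a b :: real
    and E :: "4 \<Rightarrow> 'a vfield"
    and J1 J2 J3 :: "'a endo_field"
    and g :: "'a metric_field"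
    and D :: "'a connection"
  assumes "a \<noteq> 0" and "b \<noteq> 0"
    and "lie_group L A" and "simply_connected (UNIV :: 'a set)"
    and "has_lie_algebra_g45 L A a b E"
    and "hermitian_norden_structure A E J1 J2 J3 g"
    and "levi_civita_connection A g D"
  shows
    "let T = tangent_space A;
         HW2 = (\<lambda>p. hermitian_W2 (T p) (J1 p));
         HW4 = (\<lambda>p. hermitian_W4 (T p) (g p) (\<lambda>i. E i p) (J1 p));
         NW1 = (\<lambda>J p. norden_W1 (T p) (g p) (\<lambda>i. E i p) (J p));
         NW2 = (\<lambda>J p. norden_W2 (T p) (g p) (\<lambda>i. E i p) (J p));
         NW3 = (\<lambda>J p. norden_W3 (T p) (J p));
         class1 = belongs_to A g D J1;
         class2 = belongs_to A g D J2;
         class3 = belongs_to A g D J3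
     in
       (a = -1 \<and> b = 1 \<longrightarrow>
          class1 (\<lambda>p. HW2 p) \<and>
          class2 (\<lambda>p. NW2 J2 p) \<and>
          class3 (\<lambda>p. NW1 J3 p + NW2 J3 p + NW3 J3 p)) \<and>
       (a = -1 \<and> b = -1 \<longrightarrow>
          class1 (\<lambda>p. HW2 p) \<and>
          class2 (\<lambda>p. NW1 J2 p + NW2 J2 p + NW3 J2 p) \<and>
          class3 (\<lambda>p. NW2 J3 p)) \<and>
       (a = -1 \<and> b \<noteq> 1 \<and> b \<noteq> -1 \<longrightarrow>
          class1 (\<lambda>p. HW2 p) \<and>
          class2 (\<lambda>p. NW1 J2 p + NW2 J2 p + NW3 J2 p) \<and>
          class3 (\<lambda>p. NW1 J3 p + NW2 J3 p + NW3 J3 p)) \<and>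
       (a = 1 \<and> b = 1 \<longrightarrow>
          class1 (\<lambda>p. HW4 p) \<and>
          class2 (\<lambda>p. NW1 J2 p) \<and>
          class3 (\<lambda>p. NW1 J3 p + NW2 J3 p)) \<and>
       (a = 1 \<and> b = -3 \<longrightarrow>
          class1 (\<lambda>p. HW4 p) \<and>
          class2 (\<lambda>p. NW2 J2 p + NW3 J2 p) \<and>
          class3 (\<lambda>p. NW2 J3 p + NW3 J3 p)) \<and>
       (a = 1 \<and> b \<noteq> 1 \<and> b \<noteq> -3 \<longrightarrow>
          class1 (\<lambda>p. HW4 p) \<and>
          class2 (\<lambda>p. NW1 J2 p + NW2 J2 p + NW3 J2 p) \<and>
          class3 (\<lambda>p. NW1 J3 p + NW2 J3 p + NW3 J3 p)) \<and>
       (a \<noteq> 1 \<and> a \<noteq> -1 \<and> b = 1 \<longrightarrow>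
          class1 (\<lambda>p. HW2 p + HW4 p) \<and>
          class2 (\<lambda>p. NW1 J2 p + NW2 J2 p) \<and>
          class3 (\<lambda>p. NW1 J3 p + NW2 J3 p + NW3 J3 p)) \<and>
       (a = -1/3 \<and> b = -1/3 \<longrightarrow>
          class1 (\<lambda>p. HW2 p + HW4 p) \<and>
          class2 (\<lambda>p. NW2 J2 p + NW3 J2 p) \<and>
          class3 (\<lambda>p. NW1 J3 p + NW2 J3 p)) \<and>
       (a = -1/2 * (b + 1) \<and> b \<noteq> -3 \<and> b \<noteq> -1/3 \<longrightarrow>
          class1 (\<lambda>p. HW2 p + HW4 p) \<and>
          class2 (\<lambda>p. NW2 J2 p + NW3 J2 p) \<and>
          class3 (\<lambda>p. NW1 J3 p + NW2 J3 p + NW3 J3 p)) \<and>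
       (a = b \<and> b \<noteq> 1 \<and> b \<noteq> -1 \<and> b \<noteq> -1/3 \<longrightarrow>
          class1 (\<lambda>p. HW2 p + HW4 p) \<and>
          class2 (\<lambda>p. NW1 J2 p + NW2 J2 p + NW3 J2 p) \<and>
          class3 (\<lambda>p. NW1 J3 p + NW2 J3 p)) \<and>
       (a = - b - 2 \<and> b \<noteq> -1 \<and> b \<noteq> -3 \<longrightarrow>
          class1 (\<lambda>p. HW2 p + HW4 p) \<and>
          class2 (\<lambda>p. NW1 J2 p + NW2 J2 p + NW3 J2 p) \<and>
          class3 (\<lambda>p. NW2 J3 p + NW3 J3 p)) \<and>
       (a \<noteq> 0 \<and> b \<noteq> 0 \<longrightarrow>
          class1 (\<lambda>p. HW2 p + HW4 p) \<and>
          class2 (\<lambda>p. NW1 J2 p + NW2 J2 p + NW3 J2 p) \<and>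
          class3 (\<lambda>p. NW1 J3 p + NW2 J3 p + NW3 J3 p))"
proof -
  interpret g45_lie_group L A a b E J1 J2 J3 g D
    using assms by unfold_locales
  \<comment> \<open>Some rows state in solved form that the Lee form of the second or third structure vanishes.\<close>
  have lee2_diagonal: "1 + 2 * a + b = 0" if "a = -1/3" "b = -1/3" using that by simp
  have lee2_line: "1 + 2 * a + b = 0" if "a = -1/2 * (b + 1)" using that by argo
  have lee3_line: "2 + a + b = 0" if "a = - b - 2" using that by simp
  show ?thesis
    unfolding Let_def
    by (intro conjI impI; (elim conjE)?)
      (use J1_classes J2_classes J3_classes lee2_diagonal lee2_line lee3_line in simp_all)
qed

end
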